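(* Let $\eta>0$ be a fixed constant and let $p=p(n)$ satisfy $e^{-o(\log n)}\le p\le 1-\eta$. Let $b:=\frac{1}{1-p}$. Then with high probability, \[\chi_g(G_{n,p}) \le (1+o(1))\frac{n}{\log_b (np)}.\]
   Context: $G_{n,p}$ is the Erdős–Rényi random graph on $n$ vertices where each edge is present independently with probability $p$; "with high probability" means with probability $1-o(1)$ as $n\to\infty$. The coloring game on a graph $G$ with $k$ colors: Maker and Breaker alternately (Maker first) pick an uncolored vertex and assign it one of the colors $1,\dots,k$ such that adjacent vertices never receive the same color. Maker wins iff at the end all vertices are colored (Breaker wins if a partial coloring arises that cannot be extended, i.e. some uncolored vertex has all $k$ colors in its neighborhood). The game chromatic number $\chi_g(G)$ is the smallest $k$ for which Maker has a winning strategy. *)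

theory Defs
  imports "HOL-Probability.Probability" "HOL-Library.Landau_Symbols"
begin

text \<open>
  A simple graph is given by its vertex set \<open>V\<close> and the set \<open>E\<close> of its edges, which are
  two-element subsets of \<open>V\<close>.
\<close>

section \<open>The binomial random graph\<close>

definition vertex_pairs :: "nat \<Rightarrow> nat set set" where
  "vertex_pairs n = {e. e \<subseteq> {..<n} \<and> card e = 2}"

text \<open>The distribution of the edge set of \<open>G\<^sub>n\<^sub>,\<^sub>p\<close>; the vertex set is \<open>{..<n}\<close>.\<close>

definition random_graph :: "nat \<Rightarrow> real \<Rightarrow> nat set set pmf" where
  "random_graph n p =
     map_pmf (\<lambda>present. {e \<in> vertex_pairs n. present e})
       (Pi_pmf (vertex_pairs n) False (\<lambda>_. bernoulli_pmf p))"

section \<open>The colouring game\<close>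

text \<open>
  A history of the game is the list of the moves (vertex, colour) made so far, the most recent
  one first. Vertices are never recoloured, so \<open>map_of h\<close> is the current partial colouring.
  Maker moves first, i.e. exactly at the histories of even length.
\<close>

definition legal_move ::
  "'a set \<Rightarrow> 'a set set \<Rightarrow> nat \<Rightarrow> ('a \<times> nat) list \<Rightarrow> 'a \<times> nat \<Rightarrow> bool" where
  "legal_move V E k h m \<longleftrightarrow>
     fst m \<in> V \<and> map_of h (fst m) = None \<and> snd m \<in> {1..k} \<and>
     (\<forall>u \<in> V. {u, fst m} \<in> E \<longrightarrow> map_of h u \<noteq> Some (snd m))"

text \<open>
  The histories that can arise when Maker follows the strategy \<open>\<sigma>\<close>
  and Breaker moves arbitrarily.
\<close>

inductive play ::
  "'a set \<Rightarrow> 'a set set \<Rightarrow> nat \<Rightarrow> (('a \<times> nat) list \<Rightarrow> 'a \<times> nat) \<Rightarrow> ('a \<times> nat) list \<Rightarrow> bool"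
  for V E k \<sigma> where
  start: "play V E k \<sigma> []"
| maker: "play V E k \<sigma> h \<Longrightarrow> even (length h) \<Longrightarrow> legal_move V E k h (\<sigma> h)
    \<Longrightarrow> play V E k \<sigma> (\<sigma> h # h)"
| breaker: "play V E k \<sigma> h \<Longrightarrow> odd (length h) \<Longrightarrow> legal_move V E k h m
    \<Longrightarrow> play V E k \<sigma> (m # h)"

definition game_over :: "'a set \<Rightarrow> 'a set set \<Rightarrow> nat \<Rightarrow> ('a \<times> nat) list \<Rightarrow> bool" where
  "game_over V E k h \<longleftrightarrow> (\<nexists>m. legal_move V E k h m)"

text \<open>
  The first conjunct says that \<open>\<sigma>\<close> never proposes an illegal move while the game goes on.
  A play is only evaluated when no legal move is left; this loses nothing, as a vertex that
  sees all \<open>k\<close> colours in its neighbourhood remains uncoloured until then.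
\<close>

definition winning_strategy ::
  "'a set \<Rightarrow> 'a set set \<Rightarrow> nat \<Rightarrow> (('a \<times> nat) list \<Rightarrow> 'a \<times> nat) \<Rightarrow> bool" where
  "winning_strategy V E k \<sigma> \<longleftrightarrow>
     (\<forall>h. play V E k \<sigma> h \<and> even (length h) \<and> \<not> game_over V E k h \<longrightarrow> legal_move V E k h (\<sigma> h)) \<and>
     (\<forall>h. play V E k \<sigma> h \<and> game_over V E k h \<longrightarrow> (\<forall>v \<in> V. map_of h v \<noteq> None))"

definition game_chromatic_number :: "'a set \<Rightarrow> 'a set set \<Rightarrow> nat" where
  "game_chromatic_number V E = (LEAST k. \<exists>\<sigma>. winning_strategy V E k \<sigma>)"

text \<open>On a finite graph the minimum is taken over a nonempty set.\<close>

lemma play_dom: "play V E k \<sigma> h \<Longrightarrow> dom (map_of h) \<subseteq> V"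
  unfolding dom_map_of_conv_image_fst
  by (induction rule: play.induct) (auto simp: legal_move_def)

lemma ex_winning_strategy:
  assumes "finite V"
  shows "\<exists>\<sigma>. winning_strategy V E (card V) \<sigma>"
proof -
  define \<sigma> where "\<sigma> h = (SOME m. legal_move V E (card V) h m)" for h
  have "map_of h v \<noteq> None"
    if h: "play V E (card V) \<sigma> h" and over: "game_over V E (card V) h" and v: "v \<in> V" for h v
  proof
    assume None: "map_of h v = None"
    let ?D = "dom (map_of h)"
    have "?D \<subset> V"
      using play_dom[OF h] v None by auto
    then have "card ?D < card V"
      by (rule psubset_card_mono[OF assms])
    moreover have "ran (map_of h) = (\<lambda>u. the (map_of h u)) ` ?D"
      by (force simp: ran_def dom_def image_iff)
    then have "card (ran (map_of h)) \<le> card ?D"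
      by (simp add: card_image_le finite_dom_map_of)
    ultimately have "\<not> {1..card V} \<subseteq> ran (map_of h)"
      using card_mono[OF finite_ran[OF finite_dom_map_of], of "{1..card V}" h] by auto
    then obtain i where "i \<in> {1..card V}" "i \<notin> ran (map_of h)"
      by blast
    then have "legal_move V E (card V) h (v, i)"
      using v None by (auto simp: legal_move_def ran_def)
    then show False
      using over by (auto simp: game_over_def)
  qed
  moreover have "legal_move V E (card V) h (\<sigma> h)" if "\<not> game_over V E (card V) h" for h
    using that unfolding \<sigma>_def game_over_def by (metis someI_ex)
  ultimately show ?thesis
    unfolding winning_strategy_def by blast
qed

end

theory Submission
  imports Defs "HOL-Real_Asymp.Real_Asymp"
begin

text \<open>
  Let \<open>L = log\<^sub>b (n p)\<close>, \<open>k = (1 + \<epsilon>) n / L\<close> and \<open>c = L / (1 + \<epsilon> / 2)\<close>. Maker always colours an uncoloured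
  vertex of least weight, where an available colour whose class has size \<open>s\<close> contributes
  \<open>b ^ min s c\<close> to the weight. A vertex has no neighbour in the class with probability \<open>b\<^sup>-\<^sup>s\<close>, so each of
  the many classes with \<open>s \<le> c\<close> contributes \<open>1\<close> on average, and at most \<open>b ^ c \<le> n ^ (1 - \<delta>)\<close>. By a Chernoff
  bound and a union bound over all histories, throughout any play at most \<open>\<gamma> = n ^ (1 - \<delta> + o(1))\<close>
  vertices are light, i.e. of weight below \<open>\<Lambda> = n ^ (1 - o(1))\<close>, when they are coloured. Hence, if a
  vertex runs out of colours, then at most \<open>\<gamma>\<close> moves of Maker earlier no vertex was light. From then
  on the play is a box game in which Breaker must destroy weight \<open>\<Lambda>\<close>, averaged over the vertices that
  Maker is still going to colour. The losses in the last \<open>r\<close> rounds only involve \<open>2 r\<close> colours, so that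
  a union bound over lists of \<open>r n ^ o(1)\<close> moves suffices to bound them by \<open>n ^ (1 - \<delta> + o(1))\<close> per
  vertex, and summing over \<open>r\<close> costs only another logarithm.
\<close>

section \<open>The game with weights\<close>

text \<open>A list rather than a set, because \<open>peak\<close> refers to the prefixes of a
  class.\<close>

definition colour_class :: "('a \<times> nat) list \<Rightarrow> nat \<Rightarrow> 'a list" where
  "colour_class g j = map fst (filter (\<lambda>m. snd m = j) g)"

definition no_edges :: "'a set set \<Rightarrow> 'a list \<Rightarrow> 'a \<Rightarrow> bool" where
  "no_edges E ys v \<longleftrightarrow> (\<forall>u\<in>set ys. {u, v} \<notin> E)"

text \<open>Capping the exponent at \<open>c\<close>, instead of dropping larger classes, keeps the
  weight of a colour nondecreasing for \<open>b \<ge> 1\<close> as long as the colour stays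
  available.\<close>

definition class_weight :: "real \<Rightarrow> nat \<Rightarrow> 'a set set \<Rightarrow> 'a list \<Rightarrow> 'a \<Rightarrow> real" where
  "class_weight b c E ys v = (if no_edges E ys v then b ^ min (length ys) c else 0)"

definition weight :: "real \<Rightarrow> nat \<Rightarrow> nat \<Rightarrow> 'a set set \<Rightarrow> ('a \<times> nat) list \<Rightarrow> 'a \<Rightarrow> real" where
  "weight b c k E g v = (\<Sum>j\<in>{1..k}. class_weight b c E (colour_class g j) v)"

text \<open>An upper bound on the weight of a colour for \<open>v\<close> at any time. The sum, in place of a maximum,
  makes the expectation trivial and costs only a factor \<open>c + 1\<close>.\<close>

definition peak :: "real \<Rightarrow> nat \<Rightarrow> 'a set set \<Rightarrow> 'a list \<Rightarrow> 'a \<Rightarrow> real" where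
  "peak b c E ys v =
     (\<Sum>q\<le>c. if q \<le> length ys \<and> no_edges E (take q ys) v then b ^ q else 0)"

text \<open>If \<open>v\<close> is not coloured in \<open>g\<close>, then \<open>before g v\<close> is \<open>g\<close>. Unlike the histories of the game,
  these lists are chronological.\<close>

definition before :: "('a \<times> nat) list \<Rightarrow> 'a \<Rightarrow> ('a \<times> nat) list" where
  "before g v = takeWhile (\<lambda>m. fst m \<noteq> v) g"

text \<open>Properness of the colouring is left out, so that this set does not depend on
  \<open>E\<close> and a union bound over it makes sense for random \<open>E\<close>.\<close>

definition move_lists :: "'a set \<Rightarrow> nat \<Rightarrow> ('a \<times> nat) list set" where
  "move_lists V k = {g. distinct (map fst g) \<and> set g \<subseteq> V \<times> {1..k}}"

text \<open>Every vertex is weighed at the time of its own colouring. Only edges to earlier vertices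
  matter then, which makes the weights of different vertices independent for fixed
  \<open>g\<close>.\<close>

definition few_light :: "real \<Rightarrow> nat \<Rightarrow> nat \<Rightarrow> 'a set \<Rightarrow> 'a set set \<Rightarrow> real \<Rightarrow> nat \<Rightarrow> bool" where
  "few_light b c k V E \<Lambda> \<gamma> \<longleftrightarrow>
     (\<forall>g\<in>move_lists V k. \<forall>Q\<subseteq>V. (\<forall>v\<in>Q. weight b c k E (before g v) v < \<Lambda>) \<longrightarrow> card Q \<le> \<gamma>)"

text \<open>In the application \<open>Q\<close> has as many vertices as there are rounds left, and
  \<open>J\<close> collects the colours used in these rounds, at most two per round.\<close>

definition small_peaks :: "real \<Rightarrow> nat \<Rightarrow> nat \<Rightarrow> 'a set \<Rightarrow> 'a set set \<Rightarrow> nat \<Rightarrow> real \<Rightarrow> bool" where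
  "small_peaks b c k V E r K \<longleftrightarrow>
     (\<forall>g\<in>move_lists V k. \<forall>Q\<subseteq>V. \<forall>J\<subseteq>{1..k}. Q \<noteq> {} \<and> card Q \<le> r \<and> card J \<le> 2 * card Q \<longrightarrow>
        (\<Sum>v\<in>Q. \<Sum>j\<in>J. peak b c E (colour_class (before g v) j) v) \<le> real (card Q) * K)"

section \<open>The weight of a vertex along a history\<close>

lemma colour_class_append: "colour_class (g @ h) j = colour_class g j @ colour_class h j"
  by (simp add: colour_class_def)

lemma take_Suc_append: "take (Suc i) g = take i g @ take 1 (drop i g)"
  by (metis add.commute plus_1_eq_Suc take_add)

lemma colour_class_take_Suc_other:
  "snd (g ! i) \<noteq> j \<Longrightarrow> colour_class (take (Suc i) g) j = colour_class (take i g) j"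
  by (cases "i < length g")
    (simp_all add: take_Suc_conv_app_nth colour_class_append, simp add: colour_class_def)

lemma class_weight_nonneg: "b \<ge> 1 \<Longrightarrow> class_weight b c E ys v \<ge> 0"
  by (simp add: class_weight_def)

lemma peak_nonneg: "b \<ge> 1 \<Longrightarrow> peak b c E ys v \<ge> 0"
  by (auto simp: peak_def intro!: sum_nonneg)

text \<open>Here \<open>xs\<close> is the class at an earlier time. Its weight is dominated by the
  summand of the peak with index \<open>min (length xs) c\<close>.\<close>

lemma class_weight_le_peak:
  assumes "b \<ge> 1"
  shows "class_weight b c E xs v \<le> peak b c E (xs @ ys) v"
proof (cases "no_edges E xs v")
  case True
  let ?f = "\<lambda>q. if q \<le> length (xs @ ys) \<and> no_edges E (take q (xs @ ys)) v then b ^ q else 0"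
  have "no_edges E (take (min (length xs) c) (xs @ ys)) v"
    using True by (auto simp: no_edges_def dest: in_set_takeD)
  then have "class_weight b c E xs v = ?f (min (length xs) c)"
    using True by (simp add: class_weight_def)
  also have "\<dots> \<le> sum ?f {..c}"
    by (rule member_le_sum) (use assms in auto)
  finally show ?thesis by (simp add: peak_def)
next
  case False
  then show ?thesis using peak_nonneg[OF assms] by (simp add: class_weight_def)
qed

lemma no_edges_take:
  "i \<le> l \<Longrightarrow> no_edges E (colour_class (take l g) j) v \<Longrightarrow> no_edges E (colour_class (take i g) j) v"
  using set_take_subset_set_take[of i l g] by (auto simp: no_edges_def colour_class_def)

text \<open>An available colour only gains weight, and it is lost at most once; so all losses of a
  vertex in one colour add up to a single value of the weight.\<close>

lemma sum_drops_le:
  assumes b: "b \<ge> 1"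
    and le: "\<And>i. i \<le> l \<Longrightarrow> class_weight b c E (colour_class (take i g) j) v \<le> P"
  shows "(\<Sum>i<l. max 0 (class_weight b c E (colour_class (take i g) j) v -
                        class_weight b c E (colour_class (take (Suc i) g) j) v))
         + class_weight b c E (colour_class (take l g) j) v \<le> P"
  using le
proof (induction l)
  case 0
  then show ?case by auto
next
  case (Suc l)
  let ?w = "\<lambda>i. class_weight b c E (colour_class (take i g) j) v"
  show ?case
  proof (cases "no_edges E (colour_class (take (Suc l) g) j) v")
    case True
    have "max 0 (?w i - ?w (Suc i)) = 0" if "i < Suc l" for i
    proof -
      have 1: "no_edges E (colour_class (take i g) j) v"
        "no_edges E (colour_class (take (Suc i) g) j) v"
        using that by (auto intro: no_edges_take[OF _ True])
      have "length (colour_class (take i g) j) \<le> length (colour_class (take (Suc i) g) j)"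
        by (subst take_Suc_append) (simp add: colour_class_append)
      then have "?w i \<le> ?w (Suc i)"
        using 1 b by (auto simp: class_weight_def intro!: power_increasing)
      then show ?thesis by simp
    qed
    then have "(\<Sum>i<Suc l. max 0 (?w i - ?w (Suc i))) = 0"
      by (intro sum.neutral) auto
    then show ?thesis using Suc.prems[of "Suc l"] by simp
  next
    case False
    \<comment> \<open>The weight after \<open>l\<close> moves now enters the sum as a drop, and the
      new final weight is 0, so the left-hand side is the one of the induction hypothesis.\<close>
    then have 0: "?w (Suc l) = 0" by (simp add: class_weight_def)
    have "?w l \<ge> 0" using class_weight_nonneg[OF b] .
    then have "(\<Sum>i<Suc l. max 0 (?w i - ?w (Suc i))) = (\<Sum>i<l. max 0 (?w i - ?w (Suc i))) + ?w l"
      using 0 by simp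
    then show ?thesis using Suc.IH Suc.prems 0 by auto
  qed
qed

text \<open>Move \<open>i\<close> can only cost weight in its own colour. Summing over all colours
  of \<open>J\<close> instead gives \<open>sum_drops_le\<close> once per colour.\<close>

lemma sum_window_drops_le:
  assumes b: "b \<ge> 1"
    and le: "\<And>i j. i \<le> l \<Longrightarrow> class_weight b c E (colour_class (take i g) j) v \<le> P j"
    and J: "\<And>i. i \<in> {a..<length g} \<Longrightarrow> snd (g ! i) \<in> J" "finite J"
  shows "(\<Sum>i=a..<l. max 0 (class_weight b c E (colour_class (take i g) (snd (g ! i))) v -
                        class_weight b c E (colour_class (take (Suc i) g) (snd (g ! i))) v))
         \<le> (\<Sum>j\<in>J. P j)"
proof -
  let ?w = "\<lambda>i j. class_weight b c E (colour_class (take i g) j) v"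
  let ?d = "\<lambda>i j. max 0 (?w i j - ?w (Suc i) j)"
  have "?d i (snd (g ! i)) \<le> (\<Sum>j\<in>J. ?d i j)" if "i \<ge> a" for i
  proof (cases "i < length g")
    case True
    then show ?thesis using J that by (intro member_le_sum) auto
  next
    \<comment> \<open>Beyond the end of \<open>g\<close> both prefixes equal \<open>g\<close>, so
      the drop is 0 whatever \<open>g ! i\<close> is. This case occurs when the last round consists
      of a single move.\<close>
    case False
    then show ?thesis by (simp add: sum_nonneg)
  qed
  then have "(\<Sum>i=a..<l. ?d i (snd (g ! i))) \<le> (\<Sum>i=a..<l. \<Sum>j\<in>J. ?d i j)"
    by (intro sum_mono) auto
  also have "\<dots> = (\<Sum>j\<in>J. \<Sum>i=a..<l. ?d i j)"
    by (rule sum.swap)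
  also have "\<dots> \<le> (\<Sum>j\<in>J. P j)"
  proof (rule sum_mono)
    fix j
    have "(\<Sum>i=a..<l. ?d i j) \<le> (\<Sum>i<l. ?d i j)"
      by (rule sum_mono2) auto
    also have "\<dots> \<le> P j"
      using sum_drops_le[OF b, of l c E g j v "P j"] le
        class_weight_nonneg[OF b, of c E "colour_class (take l g) j" v]
      by auto
    finally show "(\<Sum>i=a..<l. ?d i j) \<le> P j" .
  qed
  finally show ?thesis .
qed

text \<open>A move changes only the class of its own colour, so all other summands cancel.\<close>

lemma weight_drop_le:
  "weight b c k E (take i g) v - weight b c k E (take (Suc i) g) v \<le>
     max 0 (class_weight b c E (colour_class (take i g) (snd (g ! i))) v -
            class_weight b c E (colour_class (take (Suc i) g) (snd (g ! i))) v)"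
proof -
  let ?w = "\<lambda>i j. class_weight b c E (colour_class (take i g) j) v"
  let ?c = "snd (g ! i)"
  have eq: "?w (Suc i) j = ?w i j" if "j \<noteq> ?c" for j
    using that by (subst colour_class_take_Suc_other) auto
  have "weight b c k E (take i g) v - weight b c k E (take (Suc i) g) v =
      (\<Sum>j\<in>{1..k}. ?w i j - ?w (Suc i) j)"
    by (simp add: weight_def sum_subtractf)
  also have "\<dots> = (\<Sum>j\<in>{1..k}. if j = ?c then ?w i ?c - ?w (Suc i) ?c else 0)"
    using eq by (intro sum.cong) auto
  also have "\<dots> \<le> max 0 (?w i ?c - ?w (Suc i) ?c)"
    by (simp add: sum.delta)
  finally show ?thesis .
qed

text \<open>Summation by parts: as the factors \<open>1 / Suc i\<close> decrease, bounds on all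
  initial sums have the same effect as \<open>h i \<le> K\<close> for every
  \<open>i\<close>.\<close>

lemma sum_div_Suc_le:
  fixes h :: "nat \<Rightarrow> real"
  assumes "\<And>r. r \<le> R \<Longrightarrow> (\<Sum>i<r. h i) \<le> real r * K"
  shows "(\<Sum>i<R. h i / Suc i) \<le> K * (\<Sum>i<R. 1 / Suc i)"
proof -
  \<comment> \<open>Strengthened for the induction: the budget not yet spent is carried along,
    divided by the next denominator.\<close>
  have "(\<Sum>i<R. (K - h i) / Suc i) \<ge> (R * K - (\<Sum>i<R. h i)) / Suc R"
    using assms
  proof (induction R)
    case 0
    then show ?case by simp
  next
    case (Suc R)
    let ?D = "R * K - (\<Sum>i<R. h i)"
    have D: "?D \<ge> 0" "Suc R * K - (\<Sum>i<Suc R. h i) \<ge> 0" using Suc.prems[of R] Suc.prems[of "Suc R"] by auto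
    have "(Suc R * K - (\<Sum>i<Suc R. h i)) / Suc (Suc R) \<le> (Suc R * K - (\<Sum>i<Suc R. h i)) / Suc R"
      by (rule divide_left_mono[OF _ D(2)]) auto
    also have "\<dots> = ?D / Suc R + (K - h R) / Suc R"
      by (simp add: add_divide_distrib[symmetric] algebra_simps)
    also have "\<dots> \<le> (\<Sum>i<Suc R. (K - h i) / Suc i)"
      using Suc by simp
    finally show ?case .
  qed
  moreover have "(R * K - (\<Sum>i<R. h i)) / Suc R \<ge> 0" using assms[of R] by simp
  ultimately show ?thesis
    by (simp add: diff_divide_distrib sum_subtractf sum_distrib_left)
qed

lemma sum_inverse_Suc_le: "(\<Sum>i<Suc R. 1 / real (Suc i)) \<le> 1 + ln (real (Suc R))"
proof (induction R)
  case 0 then show ?case by simp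
next
  case (Suc R)
  have "ln (real (Suc R) / real (Suc (Suc R))) \<le> real (Suc R) / real (Suc (Suc R)) - 1"
    by (rule ln_le_minus_one) simp
  also have "\<dots> = - (1 / real (Suc (Suc R)))" by (simp add: field_simps)
  finally have "1 / real (Suc (Suc R)) \<le> ln (Suc (Suc R)) - ln (Suc R)"
    by (subst (asm) ln_div) auto
  then show ?case using Suc by simp
qed

section \<open>The box game and Maker's greedy strategy\<close>

lemma before_nth:
  "distinct (map fst g) \<Longrightarrow> i < length g \<Longrightarrow> before g (fst (g ! i)) = take i g"
proof -
  assume d: "distinct (map fst g)" and i: "i < length g"
  have "fst m \<noteq> fst (g ! i)" if "m \<in> set (take i g)" for m
  proof -
    obtain i' where "i' < i" "m = g ! i'" using \<open>m \<in> set (take i g)\<close> i by (auto simp: in_set_conv_nth)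
    then show ?thesis using d i nth_eq_iff_index_eq[OF d, of i' i] by auto
  qed
  then have "takeWhile (\<lambda>m. fst m \<noteq> fst (g ! i)) (take i g @ g ! i # drop (Suc i) g) = take i g"
    by (subst takeWhile_append2) auto
  then show ?thesis
    using id_take_nth_drop[OF i] by (simp add: before_def)
qed

lemma sum_pairs:
  fixes d :: "nat \<Rightarrow> real"
  shows "a \<le> l \<Longrightarrow> (\<Sum>s=a..<l. d (2 * s) + d (2 * s + 1)) = (\<Sum>i=2 * a..<2 * l. d i)"
  by (induction l rule: dec_induct) auto

text \<open>Maker always colours a vertex of least weight. Since the last moment at which all weights
  were at least \<open>\<Lambda>\<close>, she has made at most \<open>\<gamma>\<close> moves. Let \<open>Q s\<close> consist of \<open>z\<close> and
  the vertices she colours from round \<open>s\<close> on. As in the box game, removing a vertex of least weight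
  does not decrease the average weight of \<open>Q s\<close>, so the losses, averaged over \<open>Q s\<close>, add up to at
  least \<open>\<Lambda>\<close> if \<open>z\<close> ends with weight \<open>0\<close>.\<close>

lemma uncoloured_weight_pos:
  fixes V :: "'a set"
  assumes b: "b \<ge> 1" and g: "g \<in> move_lists V k"
    and few: "few_light b c k V E \<Lambda> \<gamma>" and peaks: "small_peaks b c k V E (\<gamma> + 1) K"
    and K: "K \<ge> 0" "K * (1 + ln (real \<gamma> + 2)) < \<Lambda>" and \<Lambda>: "\<Lambda> \<le> k"
    and greedy: "\<And>i v. i < length g \<Longrightarrow> even i \<Longrightarrow> v \<in> V \<Longrightarrow> v \<notin> fst ` set (take i g) \<Longrightarrow>
       weight b c k E (take i g) (fst (g ! i)) \<le> weight b c k E (take i g) v"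
    and z: "z \<in> V" "z \<notin> fst ` set g"
  shows "weight b c k E g z > 0"
proof (rule ccontr)
  assume dead: "\<not> weight b c k E g z > 0"
  define w where "w i v = weight b c k E (take i g) v" for i v
  define N where "N = length g"
  \<comment> \<open>Maker's moves have even index, so \<open>M\<close> is their number. If
    \<open>N\<close> is odd, the last round lacks Breaker's move, and \<open>take (2 * M) g\<close>
    is still \<open>g\<close>.\<close>
  define M where "M = (N + 1) div 2"
  define U where "U i = V - fst ` set (take i g)" for i
  define x where "x s = fst (g ! (2 * s))" for s
  define Q where "Q s = insert z (x ` {s..<M})" for s
  \<comment> \<open>\<open>d i v\<close> is what move \<open>i\<close> can cost \<open>v\<close>,
    and \<open>h s\<close> is the total loss in round \<open>s\<close> over the vertices that
    survive Maker's choice in that round.\<close>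
  define d where "d i v = max 0 (class_weight b c E (colour_class (take i g) (snd (g ! i))) v -
            class_weight b c E (colour_class (take (Suc i) g) (snd (g ! i))) v)" for i v
  define h where "h s = (\<Sum>v\<in>Q (s + 1). d (2 * s) v + d (2 * s + 1) v)" for s
  have dist: "distinct (map fst g)" and gV: "set g \<subseteq> V \<times> {1..k}"
    using g by (auto simp: move_lists_def)
  have lt: "2 * s < N" if "s < M" for s
    using that by (auto simp: M_def)
  have takeM: "take (2 * M) g = g"
    by (auto simp: M_def N_def)
  have zU: "z \<in> U i" for i
    using z by (auto simp: U_def dest: in_set_takeD)
  have inj: "x s = x s' \<longleftrightarrow> s = s'" if "s < M" "s' < M" for s s'
    using nth_eq_iff_index_eq[OF dist, of "2 * s" "2 * s'"] lt[OF that(1)] lt[OF that(2)]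
    by (auto simp: x_def N_def)
  have xz: "x s \<noteq> z" if "s < M" for s
    using lt[OF that] z by (auto simp: x_def N_def)
  have xV: "x s \<in> V" if "s < M" for s
    using lt[OF that] gV by (auto simp: x_def N_def dest!: nth_mem)
  have before_x: "before g (x s) = take (2 * s) g" if "s < M" for s
    using before_nth[OF dist, of "2 * s"] lt[OF that] by (simp add: x_def N_def)
  have before_z: "before g z = g"
    using z by (auto simp: before_def takeWhile_eq_all_conv)
  have finQ: "finite (Q s)" for s by (simp add: Q_def)
  have injx: "inj_on x {s..<M}" for s
    using inj by (auto simp: inj_on_def)
  have cardQ: "card (Q s) = M - s + 1" for s
  proof -
    have "z \<notin> x ` {s..<M}" using xz by force
    then show ?thesis using card_image[OF injx] by (simp add: Q_def)
  qed
  have QV: "Q s \<subseteq> V" for s using z xV by (auto simp: Q_def)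
  have xU: "x s' \<in> U (2 * s)" if "s \<le> s'" "s' < M" for s s'
  proof -
    have "before g (x s') = take (2 * s) g @ drop (2 * s) (take (2 * s') g)"
      using that before_x[OF that(2)] by (metis append_take_drop_id min.absorb1 mult_le_mono2 take_take)
    then have "set (take (2 * s) g) \<subseteq> set (before g (x s'))" by simp
    moreover have "x s' \<notin> fst ` set (before g (x s'))"
      by (auto simp: before_def dest: set_takeWhileD)
    ultimately show ?thesis using xV[OF that(2)] by (auto simp: U_def)
  qed
  have QU: "Q s \<subseteq> U (2 * s)" for s
    using zU xU by (auto simp: Q_def)
  have least: "w (2 * s) (x s) \<le> w (2 * s) v" if "s < M" "v \<in> U (2 * s)" for s v
    using greedy[of "2 * s" v] lt[OF that(1)] that(2) by (auto simp: w_def x_def N_def U_def)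

  have "1 + ln (real \<gamma> + 2) \<ge> 0" by simp
  then have \<Lambda>0: "\<Lambda> > 0" using K by (smt (verit) mult_nonneg_nonneg)
  \<comment> \<open>The rounds that start without a light uncoloured vertex. Round 0 is one of them,
    since each of the \<open>k\<close> empty classes has weight 1; \<open>M\<close> is not, because
    of \<open>z\<close>.\<close>
  define G where "G = {s. s \<le> M \<and> (\<forall>v\<in>U (2 * s). \<Lambda> \<le> w (2 * s) v)}"
  define t where "t = Max G"
  have finG: "finite G" by (simp add: G_def)
  have "0 \<in> G"
    using \<Lambda> by (auto simp: G_def w_def weight_def class_weight_def colour_class_def no_edges_def)
  then have tG: "t \<in> G" using Max_in[OF finG] by (auto simp: t_def)
  have "M \<notin> G" using dead \<Lambda>0 zU[of "2 * M"] takeM by (force simp: G_def w_def)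
  then have tM: "t < M" using tG by (cases "t = M") (auto simp: G_def)
  have light: "w (2 * s) (x s) < \<Lambda>" if st: "t < s" "s < M" for s
  proof -
    have "s \<notin> G" using Max_ge[OF finG, of s] st by (auto simp: t_def)
    then obtain v where "v \<in> U (2 * s)" "w (2 * s) v < \<Lambda>" using st by (auto simp: G_def not_le)
    then show ?thesis using least[OF st(2)] by fastforce
  qed
  have "card (x ` {t + 1..<M}) \<le> \<gamma>"
  proof -
    have "\<forall>v\<in>x ` {t + 1..<M}. weight b c k E (before g v) v < \<Lambda>"
      using light before_x by (auto simp: w_def)
    moreover have "x ` {t + 1..<M} \<subseteq> V" using xV by auto
    ultimately show ?thesis using few g by (auto simp: few_light_def)
  qed
  \<comment> \<open>Maker's choices after round \<open>t\<close> are light, hence at most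
    \<open>\<gamma>\<close>; round \<open>t\<close> itself accounts for the 1.\<close>
  then have R: "M - t \<le> \<gamma> + 1"
    using card_image[OF injx, of "t + 1"] by simp

  \<comment> \<open>Average weights at the start of round \<open>s\<close>: \<open>a s\<close> still
    counts the vertex that Maker is about to colour, \<open>B s\<close> no longer does.\<close>
  define a where "a s = (\<Sum>v\<in>Q s. w (2 * s) v) / card (Q s)" for s
  define B where "B s = (\<Sum>v\<in>Q (s + 1). w (2 * s) v) / card (Q (s + 1))" for s
  have aB: "a s \<le> B s" if "s < M" for s
  proof -
    let ?S = "\<Sum>v\<in>Q (s + 1). w (2 * s) v" and ?m = "real (card (Q (s + 1)))"
    have "{s..<M} = insert s {s + 1..<M}" using that by auto
    then have Qs: "Q s = insert (x s) (Q (s + 1))"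
      by (simp add: Q_def insert_commute)
    have notin: "x s \<notin> Q (s + 1)"
      using inj that xz by (auto simp: Q_def)
    have m0: "?m > 0" by (simp add: cardQ)
    have "?m * w (2 * s) (x s) = (\<Sum>v\<in>Q (s + 1). w (2 * s) (x s))" by simp
    also have "\<dots> \<le> ?S"
      using least[OF that] QU[of s] Qs by (intro sum_mono) auto
    finally have "?m * w (2 * s) (x s) \<le> ?S" .
    moreover have "(\<Sum>v\<in>Q s. w (2 * s) v) = w (2 * s) (x s) + ?S" "card (Q s) = Suc (card (Q (s + 1)))"
      using notin finQ by (simp_all add: Qs)
    ultimately show ?thesis using m0 by (simp add: a_def B_def field_simps)
  qed
  have Ba: "B s \<le> a (s + 1) + h s / (M - s)" if "s < M" for s
  proof -
    have "w (2 * s) v \<le> w (2 * (s + 1)) v + (d (2 * s) v + d (2 * s + 1) v)" for v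
      using weight_drop_le[of b c k E "2 * s" g v] weight_drop_le[of b c k E "2 * s + 1" g v]
      by (simp add: w_def d_def)
    then have "(\<Sum>v\<in>Q (s + 1). w (2 * s) v) \<le> (\<Sum>v\<in>Q (s + 1). w (2 * (s + 1)) v) + h s"
      unfolding h_def sum.distrib[symmetric] by (intro sum_mono)
    then have "B s \<le> ((\<Sum>v\<in>Q (s + 1). w (2 * (s + 1)) v) + h s) / card (Q (s + 1))"
      unfolding B_def by (rule divide_right_mono) simp
    also have "\<dots> = a (s + 1) + h s / (M - s)"
      using cardQ[of "s + 1"] that by (simp add: a_def add_divide_distrib Suc_diff_Suc)
    finally show ?thesis .
  qed
  have "a s \<le> (\<Sum>i=s..<M. h i / (M - i))" if "s \<le> M" for s
    using that
  proof (induction rule: inc_induct)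
    case base
    \<comment> \<open>\<open>Q M\<close> is just \<open>{z}\<close>, so \<open>a M\<close> is the
      final weight of \<open>z\<close>.\<close>
    have "a M \<le> 0" using dead takeM by (simp add: a_def Q_def w_def)
    then show ?case by simp
  next
    case (step s)
    have "a s \<le> a (Suc s) + h s / (M - s)"
      using aB Ba step by (metis Suc_eq_plus1 order_trans)
    then show ?case using step by (simp add: sum.atLeast_Suc_lessThan)
  qed
  then have "B t \<le> (\<Sum>i=t..<M. h i / (M - i))"
    using Ba[OF tM] tM by (simp add: sum.atLeast_Suc_lessThan Suc_le_eq) (smt (verit) Suc_leI)
  moreover have "\<Lambda> \<le> B t"
  proof -
    have "Q (t + 1) \<subseteq> U (2 * t)" using QU[of t] by (auto simp: Q_def)
    then have "(\<Sum>v\<in>Q (t + 1). \<Lambda>) \<le> (\<Sum>v\<in>Q (t + 1). w (2 * t) v)"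
      using tG unfolding G_def by (intro sum_mono) blast
    then show ?thesis by (simp add: B_def cardQ field_simps)
  qed
  \<comment> \<open>Rounds are counted from the end, so that the denominators become those of the
    harmonic sum.\<close>
  moreover have "(\<Sum>i=t..<M. h i / (M - i)) = (\<Sum>i<M - t. h (M - 1 - i) / Suc i)"
    by (rule sum.reindex_bij_witness[of _ "\<lambda>i. M - 1 - i" "\<lambda>i. M - 1 - i"])
      (auto simp: Suc_diff_Suc)
  moreover have "(\<Sum>i<M - t. h (M - 1 - i) / Suc i) \<le> K * (\<Sum>i<M - t. 1 / Suc i)"
  proof (rule sum_div_Suc_le)
    fix r assume r: "r \<le> M - t"
    define s0 where "s0 = M - r"
    have s0: "t \<le> s0" "s0 \<le> M" "M - s0 = r" using r tM by (auto simp: s0_def)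
    show "(\<Sum>i<r. h (M - 1 - i)) \<le> real r * K"
    proof (cases "r = 0")
      case False
      define J where "J = (\<lambda>i. snd (g ! i)) ` {2 * s0..<N}"
      have s0M: "s0 < M" using False s0 by auto
      have cQ: "card (Q (s0 + 1)) = r" using cardQ[of "s0 + 1"] s0 s0M by simp
      have "card J \<le> N - 2 * s0"
        unfolding J_def by (rule order_trans[OF card_image_le]) auto
      also have "\<dots> \<le> 2 * r" using s0 by (auto simp: M_def)
      finally have cJ: "card J \<le> 2 * card (Q (s0 + 1))" by (simp only: cQ)
      have Jk: "J \<subseteq> {1..k}" using gV by (force simp: J_def N_def dest!: nth_mem)
      \<comment> \<open>The vertex \<open>v\<close> belongs to the sets \<open>Q (s + 1)\<close>
        only until it is coloured, or to the end if it is \<open>z\<close>. So only prefixes of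
        \<open>before g v\<close> occur, and one peak per colour bounds the losses.\<close>
      have v: "(\<Sum>s\<in>{s\<in>{s0..<M}. v \<in> Q (s + 1)}. d (2 * s) v + d (2 * s + 1) v) \<le>
          (\<Sum>j\<in>J. peak b c E (colour_class (before g v) j) v)" if vQ: "v \<in> Q (s0 + 1)" for v
      proof -
        obtain l where l: "{s\<in>{s0..<M}. v \<in> Q (s + 1)} = {s0..<l}" "s0 \<le> l"
          "\<And>i. i \<le> 2 * l \<Longrightarrow> \<exists>ys. before g v = take i g @ ys"
        proof (cases "v = z")
          case True
          then have "{s\<in>{s0..<M}. v \<in> Q (s + 1)} = {s0..<M}" by (auto simp: Q_def)
          moreover have "\<exists>ys. before g v = take i g @ ys" for i
            using True before_z by (metis append_take_drop_id)
          ultimately show ?thesis using that s0 by blast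
        next
          case False
          then obtain s1 where s1: "v = x s1" "s0 < s1" "s1 < M" using vQ by (auto simp: Q_def)
          then have "{s\<in>{s0..<M}. v \<in> Q (s + 1)} = {s0..<s1}"
            using False inj by (force simp: Q_def)
          moreover have "\<exists>ys. before g v = take i g @ ys" if "i \<le> 2 * s1" for i
            using s1 before_x that by (metis append_take_drop_id min.absorb1 take_take)
          ultimately show ?thesis using that s1 by (meson less_imp_le)
        qed
        have "(\<Sum>s\<in>{s\<in>{s0..<M}. v \<in> Q (s + 1)}. d (2 * s) v + d (2 * s + 1) v) =
            (\<Sum>i=2 * s0..<2 * l. d i v)"
          using sum_pairs[OF l(2), of "\<lambda>i. d i v"] by (simp only: l(1))
        also have "\<dots> \<le> (\<Sum>j\<in>J. peak b c E (colour_class (before g v) j) v)"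
          unfolding d_def
        proof (rule sum_window_drops_le[OF b])
          fix i j assume "i \<le> 2 * l"
          then obtain ys where "before g v = take i g @ ys" using l(3) by blast
          then show "class_weight b c E (colour_class (take i g) j) v \<le>
              peak b c E (colour_class (before g v) j) v"
            using class_weight_le_peak[OF b] by (simp add: colour_class_append)
        qed (auto simp: J_def N_def)
        finally show ?thesis .
      qed
      have "(\<Sum>i<r. h (M - 1 - i)) = (\<Sum>s=s0..<M. h s)"
        using s0 s0M by (intro sum.reindex_bij_witness[of _ "\<lambda>i. M - 1 - i" "\<lambda>i. M - 1 - i"]) auto
      \<comment> \<open>As \<open>Q (s + 1) \<subseteq> Q (s0 + 1)\<close>, losses per round can be
        regrouped as losses per vertex.\<close>
      also have "\<dots> = (\<Sum>s=s0..<M. \<Sum>v\<in>{v\<in>Q (s0 + 1). v \<in> Q (s + 1)}. d (2 * s) v + d (2 * s + 1) v)"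
        unfolding h_def by (intro sum.cong refl) (auto simp: Q_def)
      also have "\<dots> = (\<Sum>v\<in>Q (s0 + 1). \<Sum>s\<in>{s\<in>{s0..<M}. v \<in> Q (s + 1)}. d (2 * s) v + d (2 * s + 1) v)"
        by (rule sum.swap_restrict) (simp_all add: finQ)
      also have "\<dots> \<le> (\<Sum>v\<in>Q (s0 + 1). \<Sum>j\<in>J. peak b c E (colour_class (before g v) j) v)"
        using v by (rule sum_mono)
      also have "\<dots> \<le> card (Q (s0 + 1)) * K"
      proof -
        have "Q (s0 + 1) \<noteq> {}" "card (Q (s0 + 1)) \<le> \<gamma> + 1" using cQ R r by (auto simp: Q_def)
        then show ?thesis using peaks g QV Jk cJ unfolding small_peaks_def by blast
      qed
      finally show ?thesis using cQ by simp
    qed simp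
  qed
  moreover have "K * (\<Sum>i<M - t. 1 / Suc i) \<le> K * (1 + ln (real \<gamma> + 2))"
  proof (rule mult_left_mono[OF _ K(1)])
    have "ln (real (M - t)) \<le> ln (real \<gamma> + 2)" using R tM by (subst ln_le_cancel_iff) auto
    moreover have "(\<Sum>i<M - t. 1 / real (Suc i)) \<le> 1 + ln (real (M - t))"
    proof -
      have "Suc (M - t - 1) = M - t" using tM by simp
      then show ?thesis using sum_inverse_Suc_le[of "M - t - 1"] by (simp only:)
    qed
    ultimately show "(\<Sum>i<M - t. 1 / real (Suc i)) \<le> 1 + ln (real \<gamma> + 2)" by linarith
  qed
  ultimately show False using K(2) by linarith
qed

text \<open>Maker plays on a vertex of least weight. Then \<open>uncoloured_weight_pos\<close>
  applies to every history that arises, and positive weight means that some colour is available; so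
  no uncoloured vertex is ever stuck.\<close>

lemma game_chromatic_number_le:
  fixes V :: "'a set"
  assumes V: "finite V" and b: "b \<ge> 1"
    and few: "few_light b c k V E \<Lambda> \<gamma>" and peaks: "small_peaks b c k V E (\<gamma> + 1) K"
    and K: "K \<ge> 0" "K * (1 + ln (real \<gamma> + 2)) < \<Lambda>" and \<Lambda>: "\<Lambda> \<le> k"
  shows "game_chromatic_number V E \<le> k"
proof -
  define U where "U h = {v \<in> V. v \<notin> fst ` set h}" for h :: "('a \<times> nat) list"
  define pick where "pick h = arg_min_on (weight b c k E (rev h)) (U h)" for h
  \<comment> \<open>Any legal colour will do: the argument only restricts the choice of the
    vertex.\<close>
  define \<sigma> where "\<sigma> h = (pick h, SOME j. legal_move V E k h (pick h, j))" for h
  have pick: "pick h \<in> U h" "\<And>v. v \<in> U h \<Longrightarrow> weight b c k E (rev h) (pick h) \<le> weight b c k E (rev h) v"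
    if "U h \<noteq> {}" for h
    using arg_min_if_finite[of "U h" "weight b c k E (rev h)"] that V
    by (auto simp: pick_def U_def not_less)
  \<comment> \<open>Histories list the latest move first, so they are reversed before weights are
    taken.\<close>
  have play: "rev h \<in> move_lists V k \<and>
      (\<forall>i<length h. even i \<longrightarrow> rev h ! i = \<sigma> (rev (take i (rev h))))" if "play V E k \<sigma> h" for h
    using that
  proof induction
    case start
    then show ?case by (simp add: move_lists_def)
  next
    case (maker h)
    then show ?case
      by (auto simp: move_lists_def legal_move_def map_of_eq_None_iff nth_append less_Suc_eq mem_Times_iff)
  next
    case (breaker h m)
    then show ?case
      by (auto simp: move_lists_def legal_move_def map_of_eq_None_iff nth_append less_Suc_eq mem_Times_iff)
  qed
  have alive: "\<exists>j. legal_move V E k h (v, j)" if h: "play V E k \<sigma> h" and v: "v \<in> U h" for h v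
  proof -
    have rh: "rev h \<in> move_lists V k" using play[OF h] by simp
    have "weight b c k E (rev h) v > 0"
    proof (rule uncoloured_weight_pos[OF b rh few peaks K \<Lambda>])
      fix i u assume i: "i < length (rev h)" "even i" and u: "u \<in> V" "u \<notin> fst ` set (take i (rev h))"
      let ?h = "rev (take i (rev h))"
      have "rev h ! i = \<sigma> ?h" using play[OF h] i by simp
      moreover have "u \<in> U ?h" using u by (simp add: U_def)
      ultimately show "weight b c k E (take i (rev h)) (fst (rev h ! i)) \<le> weight b c k E (take i (rev h)) u"
        using pick(2)[of ?h u] by (auto simp: \<sigma>_def)
    qed (use v in \<open>auto simp: U_def\<close>)
    then obtain j where j: "j \<in> {1..k}" "no_edges E (colour_class (rev h) j) v"
    proof -
      have "\<exists>j\<in>{1..k}. no_edges E (colour_class (rev h) j) v"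
      proof (rule ccontr)
        assume "\<not> ?thesis"
        then have "weight b c k E (rev h) v = 0"
          by (auto simp: weight_def class_weight_def intro!: sum.neutral)
        then show False using \<open>weight b c k E (rev h) v > 0\<close> by simp
      qed
      then show ?thesis using that by blast
    qed
    moreover have "map_of h u \<noteq> Some j" if "{u, v} \<in> E" for u
    proof
      assume "map_of h u = Some j"
      then have "(u, j) \<in> set h" by (rule map_of_SomeD)
      then have "u \<in> set (colour_class (rev h) j)" by (force simp: colour_class_def)
      then show False using j(2) that by (auto simp: no_edges_def)
    qed
    ultimately have "legal_move V E k h (v, j)"
      using v by (auto simp: legal_move_def U_def map_of_eq_None_iff)
    then show ?thesis ..
  qed
  have "winning_strategy V E k \<sigma>"
    unfolding winning_strategy_def
  proof (intro conjI allI impI ballI; elim conjE)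
    fix h assume h: "play V E k \<sigma> h" and "\<not> game_over V E k h"
    then obtain m where "legal_move V E k h m" by (auto simp: game_over_def)
    then have "U h \<noteq> {}" by (auto simp: legal_move_def U_def map_of_eq_None_iff)
    from alive[OF h pick(1)[OF this]] show "legal_move V E k h (\<sigma> h)"
      unfolding \<sigma>_def by (rule someI_ex)
  next
    fix h v assume h: "play V E k \<sigma> h" "game_over V E k h" and v: "v \<in> V"
    show "map_of h v \<noteq> None"
    proof
      assume "map_of h v = None"
      then have "v \<in> U h" using v by (auto simp: U_def map_of_eq_None_iff)
      then show False using alive[OF h(1)] h(2) by (auto simp: game_over_def)
    qed
  qed
  then show ?thesis
    unfolding game_chromatic_number_def by (intro Least_le exI)
qed

section \<open>The random graph\<close>

lemma finite_vertex_pairs: "finite (vertex_pairs n)"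
  by (rule finite_subset[of _ "Pow {..<n}"]) (auto simp: vertex_pairs_def)

lemma pair_in_vertex_pairs: "u < n \<Longrightarrow> v < n \<Longrightarrow> u \<noteq> v \<Longrightarrow> {u, v} \<in> vertex_pairs n"
  by (auto simp: vertex_pairs_def)

lemma finite_set_random_graph: "finite (set_pmf (random_graph n p))"
  unfolding random_graph_def
  by (auto simp: set_Pi_pmf finite_vertex_pairs intro!: finite_imageI finite_PiE_dflt)

lemma integrable_random_graph:
  fixes F :: "nat set set \<Rightarrow> real"
  shows "integrable (measure_pmf (random_graph n p)) F"
  by (intro integrable_measure_pmf_finite finite_set_random_graph)

text \<open>The pairs are present independently, so functions of disjoint blocks of pairs are
  independent and their expectations multiply.\<close>

lemma expectation_random_graph_prod_blocks:
  fixes F :: "'i \<Rightarrow> nat set set \<Rightarrow> real"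
  assumes I: "finite I" and B: "\<And>i. i \<in> I \<Longrightarrow> B i \<subseteq> vertex_pairs n" "disjoint_family_on B I"
    and F: "\<And>i E E'. i \<in> I \<Longrightarrow> E \<inter> B i = E' \<inter> B i \<Longrightarrow> F i E = F i E'"
  shows "measure_pmf.expectation (random_graph n p) (\<lambda>E. \<Prod>i\<in>I. F i E) =
         (\<Prod>i\<in>I. measure_pmf.expectation (random_graph n p) (F i))"
proof -
  define M where "M = Pi_pmf (vertex_pairs n) False (\<lambda>_. bernoulli_pmf p)"
  define H where "H x = {e \<in> vertex_pairs n. x e}" for x
  have G: "random_graph n p = map_pmf H M"
    by (simp add: random_graph_def M_def H_def[abs_def])
  have "prob_space.indep_vars (measure_pmf M) (\<lambda>_. count_space UNIV) (\<lambda>e x. x e) (vertex_pairs n)"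
    unfolding M_def by (rule indep_vars_Pi_pmf[OF finite_vertex_pairs])
  from prob_space.indep_vars_restrict[OF prob_space_measure_pmf this B]
  have "prob_space.indep_vars (measure_pmf M) (\<lambda>i. PiM (B i) (\<lambda>_. count_space UNIV))
      (\<lambda>i x. restrict (\<lambda>e. x e) (B i)) I" by simp
  \<comment> \<open>A finite product of discrete spaces is discrete, so measurability is
    automatic.\<close>
  moreover have "(\<lambda>x. F i {e \<in> B i. x e}) \<in> borel_measurable (PiM (B i) (\<lambda>_. count_space (UNIV :: bool set)))"
    if "i \<in> I" for i
    using finite_subset[OF B(1)[OF that] finite_vertex_pairs]
    by (subst count_space_PiM_finite) auto
  ultimately have "prob_space.indep_vars (measure_pmf M) (\<lambda>_. borel)
      (\<lambda>i x. F i {e \<in> B i. restrict x (B i) e}) I"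
    by (rule prob_space.indep_vars_compose2[OF prob_space_measure_pmf])
  also have "?this \<longleftrightarrow> prob_space.indep_vars (measure_pmf M) (\<lambda>_. borel) (\<lambda>i x. F i (H x)) I"
  proof (rule prob_space.indep_vars_cong[OF prob_space_measure_pmf])
    fix i assume i: "i \<in> I"
    show "(\<lambda>x. F i {e \<in> B i. restrict x (B i) e}) = (\<lambda>x. F i (H x))"
      by (intro ext F[OF i]) (use B(1)[OF i] in \<open>auto simp: H_def\<close>)
  qed auto
  finally have "measure_pmf.expectation M (\<lambda>x. \<Prod>i\<in>I. F i (H x)) =
      (\<Prod>i\<in>I. measure_pmf.expectation M (\<lambda>x. F i (H x)))"
  proof (rule prob_space.indep_vars_lebesgue_integral[OF prob_space_measure_pmf I])
    show "integrable (measure_pmf M) (\<lambda>x. F i (H x))" for i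
      by (intro integrable_measure_pmf_finite)
        (auto simp: M_def set_Pi_pmf finite_vertex_pairs intro!: finite_PiE_dflt)
  qed
  then show ?thesis by (simp add: G)
qed

lemma prob_no_edges:
  assumes p: "0 \<le> p" "p \<le> 1" and v: "v < n" and ys: "distinct ys" "set ys \<subseteq> {..<n} - {v}"
  shows "measure_pmf.prob (random_graph n p) {E. no_edges E ys v} = (1 - p) ^ length ys"
proof -
  define M where "M = Pi_pmf (vertex_pairs n) False (\<lambda>_. bernoulli_pmf p)"
  let ?S = "(\<lambda>u. {u, v}) ` set ys"
  have S: "?S \<subseteq> vertex_pairs n" using v ys by (auto intro!: pair_in_vertex_pairs)
  have "inj_on (\<lambda>u. {u, v}) (set ys)" by (auto simp: inj_on_def doubleton_eq_iff)
  then have card: "card ?S = length ys" by (simp add: card_image distinct_card[OF ys(1)])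
  have "measure_pmf.prob (random_graph n p) {E. no_edges E ys v} =
      measure_pmf.prob M {x. no_edges {e \<in> vertex_pairs n. x e} ys v}"
    by (simp add: random_graph_def M_def vimage_def)
  also have "{x. no_edges {e \<in> vertex_pairs n. x e} ys v} =
      Pi (vertex_pairs n) (\<lambda>e. if e \<in> ?S then {False} else UNIV)"
    using S by (auto simp: no_edges_def Pi_def split: if_splits)
  also have "measure_pmf.prob M \<dots> = (\<Prod>e\<in>vertex_pairs n. if e \<in> ?S then 1 - p else 1)"
    unfolding M_def measure_Pi_pmf_Pi[OF finite_vertex_pairs]
    by (intro prod.cong) (use p in \<open>auto simp: measure_pmf_single\<close>)
  also have "\<dots> = (\<Prod>e\<in>?S. 1 - p)"
    using S finite_vertex_pairs by (simp add: prod.If_cases Int_absorb1 Collect_mem_eq)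
  finally show ?thesis using card by simp
qed

lemma prob_ex_le:
  fixes M :: "'a pmf"
  assumes "finite X" "\<And>x. x \<in> X \<Longrightarrow> measure_pmf.prob M {E. P x E} \<le> B x"
  shows "measure_pmf.prob M {E. \<exists>x\<in>X. P x E} \<le> (\<Sum>x\<in>X. B x)"
proof -
  have "{E. \<exists>x\<in>X. P x E} = (\<Union>x\<in>X. {E. P x E})" by auto
  then have "measure_pmf.prob M {E. \<exists>x\<in>X. P x E} \<le> (\<Sum>x\<in>X. measure_pmf.prob M {E. P x E})"
    using measure_pmf.finite_measure_subadditive_finite[OF assms(1), of "\<lambda>x. {E. P x E}" M] by simp
  also have "\<dots> \<le> (\<Sum>x\<in>X. B x)" using assms(2) by (rule sum_mono)
  finally show ?thesis .
qed

text \<open>Markov's inequality; the majorant \<open>F\<close> is exponential in both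
  applications.\<close>

lemma prob_random_graph_le_expectation:
  assumes "\<And>E. E \<in> A \<Longrightarrow> F E \<ge> 1" "\<And>E. F E \<ge> 0"
  shows "measure_pmf.prob (random_graph n p) A \<le> measure_pmf.expectation (random_graph n p) F"
proof -
  have "measure_pmf.prob (random_graph n p) A = measure_pmf.expectation (random_graph n p) (indicator A)"
    by simp
  also have "\<dots> \<le> measure_pmf.expectation (random_graph n p) F"
    using assms by (intro integral_mono integrable_random_graph) (auto simp: indicator_def)
  finally show ?thesis .
qed

text \<open>Together with \<open>exp_le_linear\<close>, this reduces the exponential moment of a
  variable with values in the unit interval to its mean.\<close>

lemma exp_minus_le_linear:
  fixes x :: real
  assumes "0 \<le> x" "x \<le> 1"
  shows "exp (- x) \<le> 1 - x / 2"
proof -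
  have "1 + x \<le> exp x" by simp
  then have "1 \<le> (1 - x / 2) * (1 + x)" using assms by (simp add: algebra_simps mult_left_le)
  also have "\<dots> \<le> (1 - x / 2) * exp x" using assms by (intro mult_left_mono) auto
  finally show ?thesis by (simp add: exp_minus field_simps)
qed

lemma exp_le_linear:
  fixes x :: real
  assumes "0 \<le> x" "x \<le> 1"
  shows "exp x \<le> 1 + 2 * x"
proof -
  have "x\<^sup>2 \<le> x" using assms by (simp add: power2_eq_square mult_left_le)
  then show ?thesis using exp_bound[OF assms] by linarith
qed

section \<open>The edges that decide which colours are available\<close>

lemma before_subset: "set (before g v) \<subseteq> set g"
  by (auto simp: before_def dest: set_takeWhileD)

lemma set_colour_class: "set (colour_class g j) = {u. (u, j) \<in> set g}"
  by (force simp: colour_class_def)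

lemma distinct_colour_class: "distinct (map fst g) \<Longrightarrow> distinct (colour_class (before g v) j)"
proof -
  assume "distinct (map fst g)"
  then have "distinct (map fst (before g v))"
    by (simp add: before_def distinct_map distinct_takeWhile)
      (meson inj_on_subset set_takeWhileD subsetI)
  then show ?thesis by (simp add: colour_class_def distinct_map_filter)
qed

lemma set_colour_class_before:
  assumes "g \<in> move_lists V k"
  shows "set (colour_class (before g v) j) \<subseteq> V - {v}"
  using assms before_subset[of g v]
  by (auto simp: set_colour_class move_lists_def before_def dest: set_takeWhileD)

lemma not_both_before:
  assumes "u \<in> fst ` set (before g v)" "v \<in> fst ` set (before g u)"
  shows False
  using assms by (induction g) (auto simp: before_def split: if_splits)

text \<open>The pairs that decide whether colour \<open>j\<close> is available at \<open>v\<close>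
  when \<open>v\<close> is coloured.\<close>

definition edge_block :: "(nat \<times> nat) list \<Rightarrow> nat \<times> nat \<Rightarrow> nat set set" where
  "edge_block g = (\<lambda>(v, j). (\<lambda>u. {u, v}) ` set (colour_class (before g v) j))"

text \<open>A pair is inspected only from the endpoint coloured later, and the other endpoint has
  just one colour. So the pair determines both \<open>v\<close> and \<open>j\<close>.\<close>

lemma disjoint_edge_block:
  assumes "g \<in> move_lists V k"
  shows "disjoint_family_on (edge_block g) I"
  unfolding disjoint_family_on_def
proof (intro ballI impI, rule ccontr)
  fix a a' assume ne: "a \<noteq> a'" and "edge_block g a \<inter> edge_block g a' \<noteq> {}"
  obtain v j v' j' where a: "a = (v, j)" "a' = (v', j')" by (metis surj_pair)
  then obtain u u' where u: "(u, j) \<in> set (before g v)" "(u', j') \<in> set (before g v')" "{u, v} = {u', v'}"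
    using \<open>edge_block g a \<inter> _ \<noteq> {}\<close> by (auto simp: edge_block_def set_colour_class)
  have dist: "distinct (map fst g)" using assms by (simp add: move_lists_def)
  show False
  proof (cases "v = v'")
    case True
    then have "u = u'" using u(3) by (auto simp: doubleton_eq_iff)
    then have "j = j'" using u(1,2) dist before_subset by (metis eq_key_imp_eq_value subsetD)
    then show False using ne a True by simp
  next
    case False
    then have "u = v'" "u' = v" using u(3) by (auto simp: doubleton_eq_iff)
    then show False using not_both_before[of u g v] u(1,2) by force
  qed
qed

text \<open>Serves both Chernoff bounds, with \<open>class_weight\<close> and with
  \<open>peak\<close> for \<open>w\<close>. By the last hypothesis each factor depends only on its
  edge block, and these blocks are disjoint.\<close>

lemma expectation_prod_blocks_le:
  fixes f :: "'b \<Rightarrow> real"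
  assumes g: "g \<in> move_lists {..<n} k" and Q: "Q \<subseteq> {..<n}" and J: "finite J"
    and f0: "\<And>x. f x \<ge> 0"
    and le: "\<And>v j. v \<in> Q \<Longrightarrow> j \<in> J \<Longrightarrow>
      measure_pmf.expectation (random_graph n p) (\<lambda>E. f (w E (colour_class (before g v) j) v)) \<le> B v j"
    and w: "\<And>E E' ys v. (\<And>u. u \<in> set ys \<Longrightarrow> {u, v} \<in> E \<longleftrightarrow> {u, v} \<in> E') \<Longrightarrow> w E ys v = w E' ys v"
  shows "measure_pmf.expectation (random_graph n p)
      (\<lambda>E. \<Prod>v\<in>Q. \<Prod>j\<in>J. f (w E (colour_class (before g v) j) v)) \<le> (\<Prod>v\<in>Q. \<Prod>j\<in>J. B v j)"
proof -
  have fin: "finite Q" using Q finite_subset by blast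
  let ?F = "\<lambda>a E. f (w E (colour_class (before g (fst a)) (snd a)) (fst a))"
  have "measure_pmf.expectation (random_graph n p)
      (\<lambda>E. \<Prod>v\<in>Q. \<Prod>j\<in>J. f (w E (colour_class (before g v) j) v)) =
      measure_pmf.expectation (random_graph n p) (\<lambda>E. \<Prod>a\<in>Q \<times> J. ?F a E)"
    by (simp add: prod.cartesian_product case_prod_unfold)
  also have "\<dots> = (\<Prod>a\<in>Q \<times> J. measure_pmf.expectation (random_graph n p) (?F a))"
  proof (rule expectation_random_graph_prod_blocks[where B = "edge_block g" and F = ?F])
    show "edge_block g a \<subseteq> vertex_pairs n" if aQJ: "a \<in> Q \<times> J" for a
    proof -
      obtain v j where a: "a = (v, j)" "v \<in> Q" using aQJ by auto
      then show ?thesis using set_colour_class_before[OF g, of v j] Q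
        by (auto simp: edge_block_def intro!: pair_in_vertex_pairs)
    qed
    show "?F a E = ?F a E'" if "E \<inter> edge_block g a = E' \<inter> edge_block g a" for a E E'
    proof -
      obtain v j where a: "a = (v, j)" by (cases a)
      have "w E (colour_class (before g v) j) v = w E' (colour_class (before g v) j) v"
        using that by (intro w) (auto simp: a edge_block_def)
      then show ?thesis by (simp add: a)
    qed
  qed (use fin J disjoint_edge_block[OF g] in auto)
  also have "\<dots> \<le> (\<Prod>a\<in>Q \<times> J. B (fst a) (snd a))"
    using le f0 by (intro prod_mono) (auto intro!: integral_nonneg)
  also have "\<dots> = (\<Prod>v\<in>Q. \<Prod>j\<in>J. B v j)"
    by (simp add: prod.cartesian_product case_prod_unfold)
  finally show ?thesis .
qed

lemma sum_length_colour_class: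
  "set g \<subseteq> V \<times> {1..k} \<Longrightarrow> (\<Sum>j\<in>{1..k}. length (colour_class g j)) = length g"
proof (induction g)
  case Nil
  then show ?case by (simp add: colour_class_def)
next
  case (Cons m g)
  have "length (colour_class (m # g) j) = (if j = snd m then 1 else 0) + length (colour_class g j)" for j
    by (simp add: colour_class_def)
  then show ?case using Cons by (auto simp: sum.distrib)
qed

text \<open>Each larger class has at least \<open>c + 1\<close> of the at most \<open>n\<close>
  moves, so there are at most \<open>n / (c + 1)\<close> such classes.\<close>

lemma card_small_classes_ge:
  assumes g: "set g \<subseteq> V \<times> {1..k}" "length g \<le> n"
  shows "real (card {j\<in>{1..k}. length (colour_class g j) \<le> c}) \<ge> real k - real n / real (c + 1)"
proof -
  let ?A = "{j\<in>{1..k}. length (colour_class g j) \<le> c}" and ?B = "{j\<in>{1..k}. \<not> length (colour_class g j) \<le> c}"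
  have "card ?B * (c + 1) = (\<Sum>j\<in>?B. c + 1)" by simp
  also have "\<dots> \<le> (\<Sum>j\<in>?B. length (colour_class g j))" by (intro sum_mono) auto
  also have "\<dots> \<le> (\<Sum>j\<in>{1..k}. length (colour_class g j))" by (rule sum_mono2) auto
  also have "\<dots> \<le> n" using sum_length_colour_class[OF g(1)] g(2) by simp
  finally have "real (card ?B) * real (c + 1) \<le> real n"
    by (metis of_nat_le_iff of_nat_mult)
  then have "real (card ?B) \<le> real n / real (c + 1)" by (simp add: field_simps)
  moreover have "card ?A + card ?B = k"
  proof -
    have "?A \<union> ?B = {1..k}" "?A \<inter> ?B = {}" by auto
    then show ?thesis using card_Un_disjoint[of ?A ?B] by simp
  qed
  ultimately show ?thesis by linarith
qed

lemma length_move_list: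
  assumes "g \<in> move_lists {..<n} k"
  shows "length g \<le> n"
proof -
  have "set (map fst g) \<subseteq> {..<n}" "distinct (map fst g)" using assms by (auto simp: move_lists_def)
  then show ?thesis using card_mono[of "{..<n}" "set (map fst g)"] distinct_card[of "map fst g"] by simp
qed

lemma card_lists_le:
  assumes "finite A"
  shows "card {xs. set xs \<subseteq> A \<and> length xs \<le> N} \<le> (card A + 1) ^ N"
proof -
  have "(\<Sum>i\<le>N. M ^ i) \<le> (M + 1) ^ N" for M :: nat
  proof (induction N)
    case (Suc N)
    have "M ^ N \<le> (M + 1) ^ N" by (rule power_mono) auto
    then have "(\<Sum>i\<le>Suc N. M ^ i) \<le> (M + 1) ^ N + M * (M + 1) ^ N"
      using Suc by (simp add: add_mono)
    then show ?case by simp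
  qed simp
  then show ?thesis by (simp add: card_lists_length_le[OF assms])
qed

section \<open>Reduction to short lists of moves\<close>

lemma takeWhile_filter_swap:
  "(\<And>x. x \<in> set xs \<Longrightarrow> \<not> P x \<Longrightarrow> F x) \<Longrightarrow> takeWhile P (filter F xs) = filter F (takeWhile P xs)"
  by (induction xs) auto

lemma take_filter_eq:
  assumes "\<And>x. x \<in> set (take c ys) \<Longrightarrow> F x"
  shows "take c (filter F ys) = take c ys"
proof -
  have "filter F ys = take c ys @ filter F (drop c ys)"
    using assms by (metis append_take_drop_id filter_append filter_True)
  then show ?thesis by (cases "c \<le> length ys") (auto simp: not_le)
qed

lemma peak_take: "peak b c E (take c ys) v = peak b c E ys v"
  by (auto simp: peak_def min_def intro!: sum.cong)

text \<open>The moves that matter for the peaks of the vertices in \<open>Q\<close> with respect to the colours in \<open>J\<close>.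
  Keeping the list short is what makes the union bound over all of them affordable.\<close>

definition relevant_moves :: "nat \<Rightarrow> 'a set \<Rightarrow> nat set \<Rightarrow> ('a \<times> nat) list \<Rightarrow> ('a \<times> nat) list" where
  "relevant_moves c Q J g =
     filter (\<lambda>m. fst m \<in> Q \<or> snd m \<in> J \<and> fst m \<in> set (take c (colour_class g (snd m)))) g"

lemma relevant_moves_move_lists:
  "g \<in> move_lists V k \<Longrightarrow> relevant_moves c Q J g \<in> move_lists V k"
  by (auto simp: move_lists_def relevant_moves_def distinct_map_filter)

lemma length_relevant_moves_le:
  assumes g: "g \<in> move_lists V k" and Q: "finite Q" and J: "finite J"
  shows "length (relevant_moves c Q J g) \<le> card Q + card J * c"
proof -
  let ?h = "relevant_moves c Q J g"
  have "distinct (map fst ?h)"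
    using relevant_moves_move_lists[OF g] by (simp add: move_lists_def)
  then have "length ?h = card (set (map fst ?h))" by (metis distinct_card length_map)
  also have "\<dots> \<le> card (Q \<union> (\<Union>j\<in>J. set (take c (colour_class g j))))"
    using Q J by (intro card_mono) (auto simp: relevant_moves_def)
  also have "\<dots> \<le> card Q + card (\<Union>j\<in>J. set (take c (colour_class g j)))"
    by (rule card_Un_le)
  also have "card (\<Union>j\<in>J. set (take c (colour_class g j))) \<le> (\<Sum>j\<in>J. card (set (take c (colour_class g j))))"
    by (rule card_UN_le[OF J])
  also have "\<dots> \<le> (\<Sum>j\<in>J. c)"
    by (intro sum_mono order_trans[OF card_length]) simp
  finally show ?thesis by simp
qed

text \<open>The move of \<open>v\<close>, if any, is kept, so \<open>before\<close> cuts at the same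
  place. The first \<open>c\<close> moves of colour \<open>j\<close> are kept as well, and the peak
  does not look further.\<close>

lemma peak_relevant_moves:
  assumes v: "v \<in> Q" and j: "j \<in> J"
  shows "peak b c E (colour_class (before (relevant_moves c Q J g) v) j) v =
         peak b c E (colour_class (before g v) j) v"
proof -
  let ?F = "\<lambda>m. fst m \<in> Q \<or> snd m \<in> J \<and> fst m \<in> set (take c (colour_class g (snd m)))"
  let ?zs = "before g v"
  let ?ys = "filter (\<lambda>m. snd m = j) ?zs"
  have "before (relevant_moves c Q J g) v = filter ?F ?zs"
    unfolding before_def relevant_moves_def by (rule takeWhile_filter_swap) (use v in auto)
  then have "colour_class (before (relevant_moves c Q J g) v) j = map fst (filter ?F ?ys)"
    by (simp add: colour_class_def conj_commute)
  moreover have "take c (filter ?F ?ys) = take c ?ys"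
  proof (rule take_filter_eq)
    fix m assume m: "m \<in> set (take c ?ys)"
    \<comment> \<open>As \<open>before g v\<close> is an initial segment of \<open>g\<close>, its
      first \<open>c\<close> moves of colour \<open>j\<close> are among the first \<open>c\<close>
      of \<open>g\<close>.\<close>
    have "g = ?zs @ dropWhile (\<lambda>m. fst m \<noteq> v) g" by (simp add: before_def)
    then have "take c (colour_class g j) =
        take c (map fst ?ys) @ take (c - length ?ys) (colour_class (dropWhile (\<lambda>m. fst m \<noteq> v) g) j)"
      by (metis colour_class_append colour_class_def length_map take_append)
    moreover have "fst m \<in> set (take c (map fst ?ys))" using m by (simp add: take_map)
    ultimately have "fst m \<in> set (take c (colour_class g j))" by simp
    moreover have "snd m = j" using m by (auto dest: in_set_takeD)
    ultimately show "?F m" using j by simp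
  qed
  ultimately have "take c (colour_class (before (relevant_moves c Q J g) v) j) =
      take c (colour_class ?zs j)"
    by (simp add: take_map colour_class_def)
  then show ?thesis by (metis peak_take)
qed

section \<open>Chernoff and union bounds\<close>

context
  fixes n :: nat and p b :: real
  assumes p: "0 \<le> p" "p < 1" and b_def: "b = 1 / (1 - p)"
begin

lemma base_ge_1: "b \<ge> 1"
  using p by (simp add: b_def)

lemma base_power_mult: "b ^ q * (1 - p) ^ q = 1"
  using p by (simp add: b_def power_divide)

text \<open>Divided by \<open>b ^ c\<close>, the weight lies in the unit interval, and a class of
  size at most \<open>c\<close> has expected weight exactly 1.\<close>

lemma expectation_exp_class_weight:
  assumes v: "v < n" and ys: "distinct ys" "set ys \<subseteq> {..<n} - {v}"
  shows "measure_pmf.expectation (random_graph n p) (\<lambda>E. exp (- class_weight b c E ys v / b ^ c))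
     \<le> exp (- (if length ys \<le> c then 1 / (2 * b ^ c) else 0))"
proof -
  have b0: "b ^ c > 0" using base_ge_1 by simp
  let ?l = "length ys"
  have le: "exp (- class_weight b c E ys v / b ^ c) \<le>
     1 - (b ^ min ?l c / (2 * b ^ c)) * indicator {E. no_edges E ys v} E" for E
    using exp_minus_le_linear[of "b ^ min ?l c / b ^ c"] b0 base_ge_1
    by (auto simp: class_weight_def indicator_def power_increasing divide_le_eq)
  have "measure_pmf.expectation (random_graph n p) (\<lambda>E. exp (- class_weight b c E ys v / b ^ c)) \<le>
      measure_pmf.expectation (random_graph n p)
         (\<lambda>E. 1 - (b ^ min ?l c / (2 * b ^ c)) * indicator {E. no_edges E ys v} E)"
    by (intro integral_mono integrable_random_graph le)
  also have "\<dots> = 1 - (b ^ min ?l c / (2 * b ^ c)) * (1 - p) ^ ?l"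
    by (subst Bochner_Integration.integral_diff)
      (use p in \<open>auto simp: integrable_random_graph prob_no_edges[OF _ _ v ys]\<close>)
  also have "\<dots> \<le> 1 - (if ?l \<le> c then 1 / (2 * b ^ c) else 0)"
    using base_power_mult[of ?l] b0 p base_ge_1 by (auto simp: min_def)
  also have "\<dots> \<le> exp (- (if ?l \<le> c then 1 / (2 * b ^ c) else 0))"
    using exp_ge_add_one_self[of "- (if ?l \<le> c then 1 / (2 * b ^ c) else 0)"] by simp
  finally show ?thesis .
qed

lemma peak_le: "peak b c E ys v \<le> real (c + 1) * b ^ c"
proof -
  have "peak b c E ys v \<le> (\<Sum>q\<le>c. b ^ c)"
    unfolding peak_def using base_ge_1 by (intro sum_mono) (auto intro!: power_increasing)
  then show ?thesis by simp
qed

text \<open>Each of the \<open>c + 1\<close> summands has expectation 1, or 0 if \<open>ys\<close>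
  is too short.\<close>

lemma expectation_peak:
  assumes v: "v < n" and ys: "distinct ys" "set ys \<subseteq> {..<n} - {v}"
  shows "measure_pmf.expectation (random_graph n p) (\<lambda>E. peak b c E ys v) \<le> real (c + 1)"
proof -
  have eq: "(if q \<le> length ys \<and> no_edges E (take q ys) v then b ^ q else 0) =
      (if q \<le> length ys then b ^ q else 0) * indicator {E. no_edges E (take q ys) v} E" for q E
    by (simp add: indicator_def)
  have "measure_pmf.expectation (random_graph n p) (\<lambda>E. peak b c E ys v) =
     (\<Sum>q\<le>c. (if q \<le> length ys then b ^ q else 0) *
        measure_pmf.prob (random_graph n p) {E. no_edges E (take q ys) v})"
    unfolding peak_def eq
    by (subst Bochner_Integration.integral_sum) (auto simp: integrable_random_graph)
  also have "\<dots> \<le> (\<Sum>q\<le>c. 1)"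
  proof (rule sum_mono)
    fix q
    have "set (take q ys) \<subseteq> {..<n} - {v}" using ys set_take_subset[of q ys] by blast
    then show "(if q \<le> length ys then b ^ q else 0) *
        measure_pmf.prob (random_graph n p) {E. no_edges E (take q ys) v} \<le> 1"
      using p ys(1) base_power_mult[of q] by (subst prob_no_edges[OF _ _ v]) (auto simp: min_def)
  qed
  finally show ?thesis by simp
qed

text \<open>The divisor is the bound of \<open>peak_le\<close>; after linearising, the factor
  \<open>c + 1\<close> cancels against the mean.\<close>

lemma expectation_exp_peak:
  assumes v: "v < n" and ys: "distinct ys" "set ys \<subseteq> {..<n} - {v}"
  shows "measure_pmf.expectation (random_graph n p) (\<lambda>E. exp (peak b c E ys v / (real (c + 1) * b ^ c)))
     \<le> exp (2 / b ^ c)"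
proof -
  define W where "W = real (c + 1) * b ^ c"
  have W: "W > 0" using base_ge_1 by (auto simp: W_def intro!: mult_pos_pos)
  have le: "exp (peak b c E ys v / W) \<le> 1 + (2 / W) * peak b c E ys v" for E
    using exp_le_linear[of "peak b c E ys v / W"] W peak_le[of c E ys v, folded W_def]
      peak_nonneg[OF base_ge_1, of c E ys v]
    by auto
  have "measure_pmf.expectation (random_graph n p) (\<lambda>E. exp (peak b c E ys v / W)) \<le>
      measure_pmf.expectation (random_graph n p) (\<lambda>E. 1 + (2 / W) * peak b c E ys v)"
    by (intro integral_mono integrable_random_graph le)
  also have "\<dots> = 1 + (2 / W) * measure_pmf.expectation (random_graph n p) (\<lambda>E. peak b c E ys v)"
    by (subst Bochner_Integration.integral_add) (auto simp: integrable_random_graph)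
  also have "\<dots> \<le> 1 + (2 / W) * real (c + 1)"
    using expectation_peak[OF assms, of c] W by (intro add_left_mono mult_left_mono) auto
  also have "\<dots> = 1 + 2 / b ^ c"
  proof -
    have "2 / (x * y) * x = 2 / y" if "x \<noteq> 0" for x y :: real
      using that by simp
    then show ?thesis unfolding W_def by (metis of_nat_neq_0 Suc_eq_plus1)
  qed
  also have "\<dots> \<le> exp (2 / b ^ c)" by simp
  finally show ?thesis by (simp add: W_def)
qed

text \<open>Chernoff bound: each colour class of size at most \<open>c\<close> contributes \<open>1\<close> to the expected weight
  of a vertex, and no class contributes more than \<open>b ^ c\<close> to the weight.\<close>

lemma prob_all_light_le:
  assumes g: "g \<in> move_lists {..<n} k" and Q: "Q \<subseteq> {..<n}"
    and \<Lambda>: "3 * \<Lambda> \<le> real k - real n / real (c + 1)"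
  shows "measure_pmf.prob (random_graph n p) {E. \<forall>v\<in>Q. weight b c k E (before g v) v < \<Lambda>}
    \<le> exp (- (\<Lambda> / (2 * b ^ c)) * card Q)"
proof -
  define W where "W = b ^ c"
  have W: "W > 0" using base_ge_1 by (simp add: W_def)
  have dist: "distinct (map fst g)" and gV: "set g \<subseteq> {..<n} \<times> {1..k}"
    using g by (auto simp: move_lists_def)
  have fin: "finite Q" using Q finite_subset by blast
  define X where "X E = (\<Sum>v\<in>Q. weight b c k E (before g v) v / W)" for E
  have "measure_pmf.prob (random_graph n p) {E. \<forall>v\<in>Q. weight b c k E (before g v) v < \<Lambda>} \<le>
     measure_pmf.expectation (random_graph n p) (\<lambda>E. exp (\<Lambda> / W * card Q) * exp (- X E))"
  proof (rule prob_random_graph_le_expectation)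
    fix E assume "E \<in> {E. \<forall>v\<in>Q. weight b c k E (before g v) v < \<Lambda>}"
    then have "X E \<le> (\<Sum>v\<in>Q. \<Lambda> / W)"
      unfolding X_def using W by (intro sum_mono divide_right_mono) (auto intro: less_imp_le)
    then show "1 \<le> exp (\<Lambda> / W * card Q) * exp (- X E)"
      by (simp add: exp_add[symmetric] mult.commute)
  qed simp
  also have "\<dots> = exp (\<Lambda> / W * card Q) * measure_pmf.expectation (random_graph n p)
      (\<lambda>E. \<Prod>v\<in>Q. \<Prod>j\<in>{1..k}. exp (- class_weight b c E (colour_class (before g v) j) v / W))"
    by (simp add: X_def weight_def sum_divide_distrib sum_negf[symmetric] exp_sum fin)
  also have "\<dots> \<le> exp (\<Lambda> / W * card Q) * (\<Prod>v\<in>Q. \<Prod>j\<in>{1..k}.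
      exp (- (if length (colour_class (before g v) j) \<le> c then 1 / (2 * W) else 0)))"
  proof (intro mult_left_mono expectation_prod_blocks_le[OF g Q, where f = "\<lambda>x. exp (- x / W)"])
    show "measure_pmf.expectation (random_graph n p)
        (\<lambda>E. exp (- class_weight b c E (colour_class (before g v) j) v / W))
        \<le> exp (- (if length (colour_class (before g v) j) \<le> c then 1 / (2 * W) else 0))"
      if "v \<in> Q" for v j
      unfolding W_def using that Q
      by (intro expectation_exp_class_weight distinct_colour_class[OF dist] set_colour_class_before[OF g]) auto
    show "class_weight b c E ys v = class_weight b c E' ys v"
      if "\<And>u. u \<in> set ys \<Longrightarrow> {u, v} \<in> E \<longleftrightarrow> {u, v} \<in> E'" for E E' ys v
      using that by (simp add: class_weight_def no_edges_def)
  qed auto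
  \<comment> \<open>At least \<open>3 * \<Lambda>\<close> small classes per vertex contribute
    \<open>1 / (2 * W)\<close> each. Of the resulting 3/2, Markov's inequality consumes 1.\<close>
  also have "\<dots> \<le> exp (\<Lambda> / W * card Q) * (\<Prod>v\<in>Q. exp (- (3 * \<Lambda>) / (2 * W)))"
  proof (intro mult_left_mono prod_mono conjI prod_nonneg)
    fix v assume "v \<in> Q"
    let ?A = "{j\<in>{1..k}. length (colour_class (before g v) j) \<le> c}"
    have "length (before g v) \<le> length g" by (simp add: before_def length_takeWhile_le)
    then have "real (card ?A) \<ge> 3 * \<Lambda>"
      using card_small_classes_ge[of "before g v" "{..<n}" k n c] gV before_subset[of g v]
        length_move_list[OF g] \<Lambda> by force
    then have "3 * \<Lambda> / (2 * W) \<le> card ?A / (2 * W)"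
      using W by (intro divide_right_mono) auto
    also have "\<dots> = (\<Sum>j\<in>{1..k}. if length (colour_class (before g v) j) \<le> c then 1 / (2 * W) else 0)"
      by (simp add: sum.If_cases Int_def)
    finally show "(\<Prod>j\<in>{1..k}. exp (- (if length (colour_class (before g v) j) \<le> c then 1 / (2 * W) else 0)))
        \<le> exp (- (3 * \<Lambda>) / (2 * W))"
      by (simp add: exp_sum[symmetric] sum_negf)
  qed auto
  also have "\<dots> = exp (\<Lambda> / W * card Q + card Q * (- (3 * \<Lambda>) / (2 * W)))"
    by (subst exp_add) (simp only: prod_constant exp_of_nat_mult)
  also have "\<Lambda> / W * card Q + card Q * (- (3 * \<Lambda>) / (2 * W)) = - (\<Lambda> / (2 * W)) * card Q"
    using W by (simp add: field_simps)
  finally show ?thesis by (simp add: W_def)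
qed

text \<open>The upper tail, by the exponential moment with parameter
  \<open>1 / ((c + 1) * b ^ c)\<close>.\<close>

lemma prob_large_peaks_le:
  fixes K :: real
  assumes g: "g \<in> move_lists {..<n} k" and Q: "Q \<subseteq> {..<n}" and J: "finite J"
  shows "measure_pmf.prob (random_graph n p)
      {E. (\<Sum>v\<in>Q. \<Sum>j\<in>J. peak b c E (colour_class (before g v) j) v) > card Q * K}
    \<le> exp (card Q * card J * (2 / b ^ c) - card Q * K / (real (c + 1) * b ^ c))"
proof -
  define W where "W = real (c + 1) * b ^ c"
  have W: "W > 0" using base_ge_1 by (auto simp: W_def intro!: mult_pos_pos)
  have dist: "distinct (map fst g)" using g by (auto simp: move_lists_def)
  have fin: "finite Q" using Q finite_subset by blast
  define X where "X E = (\<Sum>v\<in>Q. \<Sum>j\<in>J. peak b c E (colour_class (before g v) j) v)" for E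
  have "measure_pmf.prob (random_graph n p) {E. X E > card Q * K} \<le>
     measure_pmf.expectation (random_graph n p) (\<lambda>E. exp (- (card Q * K / W)) * exp (X E / W))"
  proof (rule prob_random_graph_le_expectation)
    fix E assume "E \<in> {E. X E > card Q * K}"
    then have "card Q * K / W \<le> X E / W"
      using W by (intro divide_right_mono) auto
    then show "1 \<le> exp (- (card Q * K / W)) * exp (X E / W)"
      by (simp add: exp_add[symmetric])
  qed simp
  also have "\<dots> = exp (- (card Q * K / W)) * measure_pmf.expectation (random_graph n p)
      (\<lambda>E. \<Prod>v\<in>Q. \<Prod>j\<in>J. exp (peak b c E (colour_class (before g v) j) v / W))"
    by (simp add: X_def sum_divide_distrib exp_sum fin J)
  also have "\<dots> \<le> exp (- (card Q * K / W)) * (\<Prod>v\<in>Q. \<Prod>j\<in>J. exp (2 / b ^ c))"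
  proof (intro mult_left_mono expectation_prod_blocks_le[OF g Q J, where f = "\<lambda>x. exp (x / W)"])
    show "measure_pmf.expectation (random_graph n p)
        (\<lambda>E. exp (peak b c E (colour_class (before g v) j) v / W)) \<le> exp (2 / b ^ c)"
      if "v \<in> Q" for v j
      unfolding W_def using that Q
      by (intro expectation_exp_peak distinct_colour_class[OF dist] set_colour_class_before[OF g]) auto
    show "peak b c E ys v = peak b c E' ys v"
      if "\<And>u. u \<in> set ys \<Longrightarrow> {u, v} \<in> E \<longleftrightarrow> {u, v} \<in> E'" for E E' ys v
    proof -
      have "no_edges E (take q ys) v = no_edges E' (take q ys) v" for q
        using that unfolding no_edges_def by (meson in_set_takeD)
      then show ?thesis by (simp add: peak_def)
    qed
  qed auto
  also have "\<dots> = exp (card Q * card J * (2 / b ^ c) - card Q * K / W)"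
    by (simp add: exp_diff exp_minus exp_of_nat_mult[symmetric] field_simps)
  finally show ?thesis by (simp add: X_def W_def)
qed

text \<open>A union bound over complete move lists and all sets \<open>Q\<close>. It is affordable
  because the exponent will be of larger order than \<open>n * ln n\<close>.\<close>

lemma prob_not_few_light_le:
  assumes \<Lambda>: "3 * \<Lambda> \<le> real k - real n / real (c + 1)" "\<Lambda> \<ge> 0"
  shows "measure_pmf.prob (random_graph n p) {E. \<not> few_light b c k {..<n} E \<Lambda> \<gamma>}
    \<le> (real n * real k + 1) ^ n * 2 ^ n * exp (- (\<Lambda> / (2 * b ^ c)) * (real \<gamma> + 1))"
proof -
  let ?L = "{g. set g \<subseteq> {..<n} \<times> {1..k} \<and> length g \<le> n}"
  define X where "X = {(g, Q). g \<in> move_lists {..<n} k \<and> Q \<subseteq> {..<n} \<and> card Q > \<gamma>}"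
  have sub: "X \<subseteq> ?L \<times> Pow {..<n}"
    using length_move_list by (auto simp: X_def) (auto simp: move_lists_def)
  have fin: "finite (?L \<times> Pow {..<n})" by (intro finite_cartesian_product finite_lists_length_le) auto
  have b1: "b ^ c > 0" using p by (simp add: b_def)
  have "{E. \<not> few_light b c k {..<n} E \<Lambda> \<gamma>} =
      {E. \<exists>x\<in>X. \<forall>v\<in>snd x. weight b c k E (before (fst x) v) v < \<Lambda>}"
    by (auto simp: few_light_def X_def not_le)
  also have "measure_pmf.prob (random_graph n p) \<dots> \<le> (\<Sum>x\<in>X. exp (- (\<Lambda> / (2 * b ^ c)) * (real \<gamma> + 1)))"
  proof (rule prob_ex_le)
    fix x assume "x \<in> X"
    then have x: "fst x \<in> move_lists {..<n} k" "snd x \<subseteq> {..<n}" "card (snd x) > \<gamma>"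
      by (auto simp: X_def)
    have "measure_pmf.prob (random_graph n p) {E. \<forall>v\<in>snd x. weight b c k E (before (fst x) v) v < \<Lambda>}
        \<le> exp (- (\<Lambda> / (2 * b ^ c)) * card (snd x))"
      by (rule prob_all_light_le[OF x(1,2) \<Lambda>(1)])
    also have "\<dots> \<le> exp (- (\<Lambda> / (2 * b ^ c)) * (real \<gamma> + 1))"
      using x(3) \<Lambda>(2) b1 by (auto intro!: divide_right_mono mult_left_mono)
    finally show "measure_pmf.prob (random_graph n p)
        {E. \<forall>v\<in>snd x. weight b c k E (before (fst x) v) v < \<Lambda>}
        \<le> exp (- (\<Lambda> / (2 * b ^ c)) * (real \<gamma> + 1))" .
  qed (use sub fin finite_subset in blast)
  also have "\<dots> = card X * exp (- (\<Lambda> / (2 * b ^ c)) * (real \<gamma> + 1))" by simp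
  also have "\<dots> \<le> ((real n * real k + 1) ^ n * 2 ^ n) * exp (- (\<Lambda> / (2 * b ^ c)) * (real \<gamma> + 1))"
  proof (rule mult_right_mono)
    have "card X \<le> card ?L * card (Pow {..<n})"
      using card_mono[OF fin sub] by (simp add: card_cartesian_product)
    also have "\<dots> \<le> (n * k + 1) ^ n * 2 ^ n"
      using card_lists_le[of "{..<n} \<times> {1..k}" n]
      by (intro mult_mono) (auto simp: card_Pow)
    finally have "real (card X) \<le> real ((n * k + 1) ^ n * 2 ^ n)" by (rule of_nat_mono)
    then show "real (card X) \<le> (real n * real k + 1) ^ n * 2 ^ n" by (simp add: add.commute)
  qed simp
  finally show ?thesis .
qed

text \<open>For \<open>card Q = s\<close>, the relevant moves form a list of length at most
  \<open>s * (2 * c + 1)\<close>. So the number of choices and the tail bound are both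
  \<open>s\<close>-th powers, and their product \<open>\<rho> ^ s\<close> is at most
  \<open>\<rho>\<close>.\<close>

lemma prob_not_small_peaks_le:
  fixes K :: real and k c r :: nat
  defines "\<rho> \<equiv> (real n * real k + 1) ^ (2 * c + 1) * real n * (real k + 1)\<^sup>2 *
     exp (4 * real r / b ^ c - K / (real (c + 1) * b ^ c))"
  assumes \<rho>: "\<rho> \<le> 1"
  shows "measure_pmf.prob (random_graph n p) {E. \<not> small_peaks b c k {..<n} E r K} \<le> real r * \<rho>"
proof -
  define W where "W = real (c + 1) * b ^ c"
  have b1: "b ^ c > 0" using p by (simp add: b_def)
  define L where "L s = {g. set g \<subseteq> {..<n} \<times> {1..k} \<and> length g \<le> s * (2 * c + 1)}" for s
  \<comment> \<open>Sets are encoded as lists because the numbers of lists are bounded by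
    \<open>s\<close>-th powers.\<close>
  define LQ where "LQ s = {xs. set xs \<subseteq> {..<n} \<and> length xs = s}" for s
  define LJ where "LJ s = {xs. set xs \<subseteq> {1..k} \<and> length xs \<le> 2 * s}" for s
  define X where "X s = {x \<in> L s \<times> LQ s \<times> LJ s. fst x \<in> move_lists {..<n} k \<and> distinct (fst (snd x))}" for s
  define large where "large x E \<longleftrightarrow> (\<Sum>v\<in>set (fst (snd x)). \<Sum>j\<in>set (snd (snd x)).
      peak b c E (colour_class (before (fst x) v) j) v) > real (card (set (fst (snd x)))) * K"
    for x :: "(nat \<times> nat) list \<times> nat list \<times> nat list" and E
  have fin: "finite (L s)" "finite (LQ s)" "finite (LJ s)" for s
    unfolding L_def LQ_def LJ_def by (auto intro!: finite_lists_length_le finite_lists_length_eq)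
  have finX: "finite (X s)" for s
    unfolding X_def using fin by auto
  have sub: "{E. \<not> small_peaks b c k {..<n} E r K} \<subseteq> {E. \<exists>s\<in>{1..r}. \<exists>x\<in>X s. large x E}"
  proof safe
    fix E assume "\<not> small_peaks b c k {..<n} E r K"
    then obtain g Q J where g: "g \<in> move_lists {..<n} k" and Q: "Q \<subseteq> {..<n}" "Q \<noteq> {}" "card Q \<le> r"
      and J: "J \<subseteq> {1..k}" "card J \<le> 2 * card Q"
      and lt: "(\<Sum>v\<in>Q. \<Sum>j\<in>J. peak b c E (colour_class (before g v) j) v) > real (card Q) * K"
      by (auto simp: small_peaks_def not_le)
    have finQ: "finite Q" and finJ: "finite J" using Q J finite_subset by blast+
    obtain qs where qs: "set qs = Q" "distinct qs" using finite_distinct_list[OF finQ] by blast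
    obtain js where js: "set js = J" "distinct js" using finite_distinct_list[OF finJ] by blast
    let ?h = "relevant_moves c Q J g"
    have h: "?h \<in> move_lists {..<n} k" by (rule relevant_moves_move_lists[OF g])
    have "length ?h \<le> card Q + card J * c" by (rule length_relevant_moves_le[OF g finQ finJ])
    also have "\<dots> \<le> card Q + (2 * card Q) * c" using J(2) by (intro add_left_mono mult_right_mono) auto
    finally have "?h \<in> L (card Q)" using h by (auto simp: L_def move_lists_def algebra_simps)
    moreover have "qs \<in> LQ (card Q)" using qs Q distinct_card[OF qs(2)] by (auto simp: LQ_def)
    moreover have "js \<in> LJ (card Q)" using js J distinct_card[OF js(2)] by (auto simp: LJ_def)
    ultimately have "(?h, qs, js) \<in> X (card Q)" using h qs by (simp add: X_def)
    moreover have "large (?h, qs, js) E"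
      using lt by (simp add: large_def qs js peak_relevant_moves)
    moreover have "card Q \<in> {1..r}" using Q finQ by (simp add: Suc_le_eq card_gt_0_iff)
    ultimately show "\<exists>s\<in>{1..r}. \<exists>x\<in>X s. large x E" by blast
  qed
  have "measure_pmf.prob (random_graph n p) {E. \<not> small_peaks b c k {..<n} E r K} \<le>
      measure_pmf.prob (random_graph n p) {E. \<exists>s\<in>{1..r}. \<exists>x\<in>X s. large x E}"
    by (rule measure_pmf.finite_measure_mono[OF sub]) simp
  also have "\<dots> \<le> (\<Sum>s\<in>{1..r}. \<rho>)"
  proof (rule prob_ex_le)
    fix s assume s: "s \<in> {1..r}"
    let ?e = "exp (4 * real r / b ^ c - K / W)"
    have "measure_pmf.prob (random_graph n p) {E. \<exists>x\<in>X s. large x E} \<le> (\<Sum>x\<in>X s. ?e ^ s)"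
    proof (rule prob_ex_le[OF finX])
      fix x assume "x \<in> X s"
      then obtain g qs js where x: "x = (g, qs, js)" "g \<in> move_lists {..<n} k" "set qs \<subseteq> {..<n}"
        "distinct qs" "length qs = s" "length js \<le> 2 * s"
        by (auto simp: X_def LQ_def LJ_def)
      have cards: "card (set qs) = s" "card (set js) \<le> 2 * s"
        using x distinct_card[of qs] card_length[of js] by auto
      have "measure_pmf.prob (random_graph n p) {E. large x E}
        \<le> exp (card (set qs) * card (set js) * (2 / b ^ c) - card (set qs) * K / W)"
        using prob_large_peaks_le[OF x(2,3), where J = "set js" and K = K and c = c] by (simp add: large_def x(1) W_def)
      \<comment> \<open>Of the two factors \<open>s\<close> in the first term, one is replaced by
        \<open>r\<close>, so that the exponent becomes linear in \<open>s\<close>.\<close>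
      also have "\<dots> \<le> exp (real s * (2 * real r) * (2 / b ^ c) - real s * K / W)"
        using b1 cards s by (auto intro!: divide_right_mono mult_left_mono)
      also have "\<dots> = exp (real s * (4 * real r / b ^ c - K / W))"
        by (simp add: algebra_simps)
      also have "\<dots> = ?e ^ s" by (rule exp_of_nat_mult)
      finally show "measure_pmf.prob (random_graph n p) {E. large x E} \<le> ?e ^ s" .
    qed
    also have "\<dots> = card (X s) * ?e ^ s" by simp
    also have "\<dots> \<le> ((real n * real k + 1) ^ (2 * c + 1) * real n * (real k + 1)\<^sup>2) ^ s * ?e ^ s"
    proof (rule mult_right_mono)
      have "card (X s) \<le> card (L s \<times> LQ s \<times> LJ s)"
        using fin by (intro card_mono) (auto simp: X_def)
      also have "\<dots> = card (L s) * (card (LQ s) * card (LJ s))" by (simp add: card_cartesian_product)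
      also have "\<dots> \<le> (n * k + 1) ^ (s * (2 * c + 1)) * (n ^ s * (k + 1) ^ (2 * s))"
        using card_lists_le[of "{..<n} \<times> {1..k}" "s * (2 * c + 1)"] card_lists_le[of "{1..k}" "2 * s"]
          card_lists_length_eq[of "{..<n}" s]
        by (intro mult_mono) (auto simp: L_def LQ_def LJ_def)
      also have "\<dots> = ((n * k + 1) ^ (2 * c + 1) * n * (k + 1)\<^sup>2) ^ s"
        by (simp only: power_mult_distrib power_mult mult.commute[of s] mult.assoc)
      finally have "real (card (X s)) \<le> real (((n * k + 1) ^ (2 * c + 1) * n * (k + 1)\<^sup>2) ^ s)"
        by (rule of_nat_mono)
      then show "real (card (X s)) \<le> ((real n * real k + 1) ^ (2 * c + 1) * real n * (real k + 1)\<^sup>2) ^ s"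
        by (simp only: of_nat_power of_nat_mult of_nat_add of_nat_1)
    qed simp
    also have "\<dots> = \<rho> ^ s" by (simp only: \<rho>_def W_def power_mult_distrib)
    also have "\<dots> \<le> \<rho> ^ 1"
    proof (rule power_decreasing)
      show "0 \<le> \<rho>" by (simp add: \<rho>_def)
    qed (use s \<rho> in auto)
    finally show "measure_pmf.prob (random_graph n p) {E. \<exists>x\<in>X s. large x E} \<le> \<rho>" by simp
  qed simp
  finally show ?thesis by simp
qed

end

section \<open>The choice of the parameters\<close>

text \<open>The number \<open>t\<close> exceeds all logarithmic quantities and
  \<open>8 / \<epsilon>\<close>, while \<open>W * t ^ 20\<close> is still at most \<open>n\<close>.
  All estimates thereby become comparisons of powers of \<open>t\<close>.\<close>

lemma prob_game_chromatic_number_le: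
  fixes n :: nat and p b t \<epsilon> L :: real
  defines "W \<equiv> b ^ nat \<lfloor>L / (1 + \<epsilon> / 2)\<rfloor>"
  assumes p: "0 \<le> p" "p < 1" and b_def: "b = 1 / (1 - p)"
    and \<epsilon>: "0 < \<epsilon>" "\<epsilon> \<le> 1" and t: "t \<ge> 10" "t \<ge> 8 / \<epsilon>"
    and L: "L \<ge> 2" "L + 1 \<le> t" and lnn: "ln (real n) \<le> t" and W: "W * t ^ 20 \<le> real n"
  shows "measure_pmf.prob (random_graph n p)
      {E. real (game_chromatic_number {..<n} E) \<le> (1 + \<epsilon>) * (real n / L)} \<ge> 1 - 2 * exp (- t)"
proof -
  define c where "c = nat \<lfloor>L / (1 + \<epsilon> / 2)\<rfloor>"
  define k where "k = nat \<lfloor>(1 + \<epsilon>) * (real n / L)\<rfloor>"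
  \<comment> \<open>With these values
    \<open>\<Lambda> * \<gamma> / (2 * W) \<ge> n * t ^ 3 / 2\<close> beats the
    \<open>4 * n * t\<close> of the first union bound, \<open>K / ((c + 1) * W) \<ge> t ^ 7\<close>
    beats the \<open>O(t ^ 5)\<close> of the second, and \<open>K\<close> times the logarithm is at
    most \<open>W * t ^ 10\<close>, hence below \<open>\<Lambda>\<close>.\<close>
  define \<Lambda> where "\<Lambda> = real n / t\<^sup>2"
  define \<gamma> where "\<gamma> = nat \<lceil>W * t ^ 5\<rceil>"
  define K where "K = W * t ^ 8"
  have Wc: "W = b ^ c" by (simp add: W_def c_def)
  have b1: "b \<ge> 1" using p by (simp add: b_def)
  have W1: "W \<ge> 1" using b1 by (simp add: Wc)
  have tpow: "t ^ i \<le> t ^ j" if "i \<le> j" for i j using that t by (intro power_increasing) auto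
  \<comment> \<open>Surplus powers of \<open>t\<close> are traded for constants, as
    \<open>t \<ge> 10\<close>.\<close>
  have Wt: "W * t ^ i * 10 ^ (20 - i) \<le> real n" if "i \<le> 20" for i
  proof -
    have "W * t ^ i * 10 ^ (20 - i) \<le> W * t ^ i * t ^ (20 - i)"
      using W1 t by (intro mult_left_mono power_mono mult_nonneg_nonneg) auto
    also have "\<dots> = W * t ^ 20" using that by (simp add: power_add[symmetric])
    finally show ?thesis using W by linarith
  qed
  have n_t: "real n \<ge> t ^ i * 10 ^ (20 - i)" if "i \<le> 20" for i
  proof -
    have "1 * (t ^ i * 10 ^ (20 - i)) \<le> W * (t ^ i * 10 ^ (20 - i))"
      using W1 t by (intro mult_right_mono) auto
    then show ?thesis using Wt[OF that] by (simp add: mult.assoc)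
  qed
  have n: "real n \<ge> 10 ^ 20" using n_t[of 0] by simp
  then have n0: "n > 0" and n4: "real n \<ge> 4" by (auto intro: gr0I)
  have nexp: "real n \<le> exp t" using lnn n0 by (metis exp_le_cancel_iff exp_ln of_nat_0_less_iff)
  have W5: "1 \<le> W * t ^ 5"
  proof -
    have "1 * 1 \<le> W * t ^ 5" using W1 t by (intro mult_mono one_le_power) auto
    then show ?thesis by simp
  qed
  have \<gamma>: "W * t ^ 5 \<le> \<gamma>" "real \<gamma> \<le> W * t ^ 5 + 1"
    using W5 of_int_ceiling_le_add_one[of "W * t ^ 5"] by (auto simp: \<gamma>_def)
  have \<gamma>n: "real \<gamma> + 2 \<le> 4 * (W * t ^ 5)" "real \<gamma> + 2 \<le> real n"
    using \<gamma> W5 Wt[of 5] by auto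
  have k: "real k \<le> (1 + \<epsilon>) * (real n / L)" "real k \<ge> (1 + \<epsilon>) * (real n / L) - 1"
    using \<epsilon> L real_of_int_floor_gt_diff_one[of "(1 + \<epsilon>) * (real n / L)"] by (auto simp: k_def)
  have "(1 + \<epsilon>) * (real n / L) \<le> 2 * (real n / 2)"
    using \<epsilon> L by (intro mult_mono divide_left_mono) auto
  then have kn: "real k \<le> real n" using k by simp
  have c: "real c + 1 \<ge> L / (1 + \<epsilon> / 2)" "real c \<le> L"
  proof -
    show "real c + 1 \<ge> L / (1 + \<epsilon> / 2)"
      using \<epsilon> L real_of_int_floor_gt_diff_one[of "L / (1 + \<epsilon> / 2)"] by (auto simp: c_def)
    have "real c \<le> L / (1 + \<epsilon> / 2)" using \<epsilon> L by (auto simp: c_def)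
    also have "\<dots> \<le> L / 1" using \<epsilon> L by (intro divide_left_mono) auto
    finally show "real c \<le> L" by simp
  qed
  \<comment> \<open>The gap between \<open>1 + \<epsilon>\<close> in \<open>k\<close> and
    \<open>1 + \<epsilon> / 2\<close> in \<open>c\<close> leaves at least
    \<open>\<epsilon> / 2 * (n / L) - 1\<close> small classes. Since \<open>L \<le> t\<close> and
    \<open>t \<ge> 8 / \<epsilon>\<close>, this is at least
    \<open>4 * \<Lambda> - 1\<close>.\<close>
  have \<Lambda>: "3 * \<Lambda> \<le> real k - real n / real (c + 1)"
  proof -
    have "real n / real (c + 1) \<le> real n / (L / (1 + \<epsilon> / 2))"
      using c \<epsilon> L by (intro divide_left_mono) (auto simp: add.commute)
    also have "\<dots> = (1 + \<epsilon> / 2) * (real n / L)" using L by simp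
    finally have le: "real n / real (c + 1) \<le> (1 + \<epsilon> / 2) * (real n / L)" .
    have "real k - real n / real (c + 1) \<ge> \<epsilon> / 2 * (real n / L) - 1"
    proof -
      define y where "y = real n / L"
      show ?thesis
        using k(2) le by (simp add: y_def[symmetric] algebra_simps)
    qed
    moreover have "\<epsilon> / 2 * (real n / L) \<ge> \<epsilon> / 2 * (real n / t)"
      using \<epsilon> L t by (intro mult_left_mono divide_left_mono) auto
    moreover have "\<epsilon> / 2 * (real n / t) \<ge> 4 * \<Lambda>"
    proof -
      have "4 \<le> \<epsilon> / 2 * t" using t \<epsilon> by (simp add: field_simps)
      then have "4 * (real n / t\<^sup>2) \<le> (\<epsilon> / 2 * t) * (real n / t\<^sup>2)" by (intro mult_right_mono) auto
      then show ?thesis using t by (simp add: \<Lambda>_def power2_eq_square)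
    qed
    moreover have "\<Lambda> \<ge> 1" using n_t[of 2] t by (simp add: \<Lambda>_def field_simps)
    ultimately show ?thesis by linarith
  qed
  have \<Lambda>0: "\<Lambda> \<ge> 0" by (simp add: \<Lambda>_def)
  have \<Lambda>k: "\<Lambda> \<le> real k" using \<Lambda> \<Lambda>0 by (smt (verit) divide_nonneg_nonneg of_nat_0_le_iff)
  have K0: "K \<ge> 0" using W1 t by (simp add: K_def)
  have K\<Lambda>: "K * (1 + ln (real \<gamma> + 2)) < \<Lambda>"
  proof -
    have "ln (real \<gamma> + 2) \<le> ln (real n)" using \<gamma>n n0 by (subst ln_le_cancel_iff) auto
    moreover have "2 * t \<le> t * t" using t by (intro mult_right_mono) auto
    ultimately have "1 + ln (real \<gamma> + 2) \<le> t * t" using lnn t by linarith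
    then have "K * (1 + ln (real \<gamma> + 2)) \<le> K * (t * t)"
      using K0 by (rule mult_left_mono)
    also have "\<dots> = W * t ^ 10" by (simp add: K_def eval_nat_numeral)
    also have "\<dots> < \<Lambda>"
    proof -
      have "W * t ^ 10 * t\<^sup>2 * 2 \<le> W * t ^ 12 * 10 ^ (20 - 12)"
        using W1 t by (simp add: eval_nat_numeral)
      moreover have "W * t ^ 10 * t\<^sup>2 > 0" using W1 t by simp
      ultimately have "W * t ^ 10 * t\<^sup>2 < real n" using Wt[of 12] by linarith
      then show ?thesis using t by (simp add: \<Lambda>_def field_simps)
    qed
    finally show ?thesis .
  qed
  have nk: "real n * real k + 1 \<le> real n ^ 3"
  proof -
    have "real n * real k \<le> real n * real n" using kn by (intro mult_left_mono) auto
    moreover have "1 \<le> real n * real n" using mult_mono[OF n4 n4] by simp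
    moreover have "2 * (real n * real n) \<le> real n * (real n * real n)" using n4 by (intro mult_right_mono) auto
    ultimately show ?thesis by (simp add: eval_nat_numeral)
  qed
  have nexp': "real n ^ i \<le> exp (real i * t)" for i
    using power_mono[OF nexp, of i] by (simp add: exp_of_nat_mult)

  let ?M = "measure_pmf.prob (random_graph n p)"
  have A: "?M {E. \<not> few_light b c k {..<n} E \<Lambda> \<gamma>} \<le> exp (- t)"
  proof -
    have "?M {E. \<not> few_light b c k {..<n} E \<Lambda> \<gamma>} \<le>
        (real n * real k + 1) ^ n * 2 ^ n * exp (- (\<Lambda> / (2 * W)) * (real \<gamma> + 1))"
      unfolding Wc by (rule prob_not_few_light_le[OF p b_def \<Lambda> \<Lambda>0])
    also have "\<dots> \<le> (real n ^ 3) ^ n * real n ^ n * exp (- (real n * t ^ 3 / 2))"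
    proof (intro mult_mono power_mono nk)
      have "real n * t ^ 3 / 2 = \<Lambda> / (2 * W) * (W * t ^ 5)"
        using W1 t by (simp add: \<Lambda>_def field_simps eval_nat_numeral)
      also have "\<dots> \<le> \<Lambda> / (2 * W) * (real \<gamma> + 1)"
        using \<gamma> \<Lambda>0 W1 by (intro mult_left_mono) auto
      finally show "exp (- (\<Lambda> / (2 * W)) * (real \<gamma> + 1)) \<le> exp (- (real n * t ^ 3 / 2))" by simp
    qed (use n4 in auto)
    also have "(real n ^ 3) ^ n * real n ^ n = (real n ^ 4) ^ n"
      by (simp add: power_mult_distrib[symmetric] eval_nat_numeral mult_ac)
    also have "(real n ^ 4) ^ n \<le> exp (4 * t) ^ n"
      using nexp'[of 4] by (intro power_mono) auto
    also have "exp (4 * t) ^ n * exp (- (real n * t ^ 3 / 2)) = exp (real n * (4 * t - t ^ 3 / 2))"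
      by (simp add: exp_of_nat_mult[symmetric] exp_add[symmetric] algebra_simps)
    also have "\<dots> \<le> exp (- t)"
    proof -
      have "t * 10\<^sup>2 \<le> t * t\<^sup>2" using t by (intro mult_left_mono power_mono) auto
      then have "4 * t - t ^ 3 / 2 \<le> - t" using t by (simp add: eval_nat_numeral)
      then have "real n * (4 * t - t ^ 3 / 2) \<le> real n * (- t)" by (intro mult_left_mono) auto
      also have "\<dots> \<le> 1 * (- t)" using n4 t by (intro mult_right_mono_neg) auto
      finally show ?thesis by simp
    qed
    finally show ?thesis by simp
  qed
  define \<rho> where "\<rho> = (real n * real k + 1) ^ (2 * c + 1) * real n * (real k + 1)\<^sup>2 *
     exp (4 * real (\<gamma> + 1) / b ^ c - K / (real (c + 1) * b ^ c))"
  have \<rho>: "\<rho> \<le> exp (- (2 * t))"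
  proof -
    have "\<rho> \<le> exp (3 * t) ^ (2 * c + 1) * exp t * (exp (2 * t))\<^sup>2 * exp (16 * t ^ 5 - t ^ 7)"
      unfolding \<rho>_def
    proof (intro mult_mono power_mono)
      show "real n * real k + 1 \<le> exp (3 * t)" using nk nexp'[of 3] by simp
      have "4 * real n \<le> real n * real n" using n4 by (intro mult_right_mono) auto
      then have "real n + 1 \<le> real n * real n" using n4 by linarith
      then show "real k + 1 \<le> exp (2 * t)" using kn nexp'[of 2] by (simp add: power2_eq_square)
      have "4 * real (\<gamma> + 1) / W \<le> 4 * (4 * (W * t ^ 5)) / W"
        using \<gamma>n W1 by (intro divide_right_mono) auto
      also have "\<dots> = 16 * t ^ 5" using W1 by simp
      finally have 1: "4 * real (\<gamma> + 1) / W \<le> 16 * t ^ 5" .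
      have "t ^ 7 = W * t ^ 8 / (t * W)" using W1 t by (simp add: eval_nat_numeral)
      also have "\<dots> \<le> K / (real (c + 1) * W)"
        unfolding K_def using W1 t c L by (intro divide_left_mono mult_right_mono) auto
      finally show "exp (4 * real (\<gamma> + 1) / b ^ c - K / (real (c + 1) * b ^ c)) \<le> exp (16 * t ^ 5 - t ^ 7)"
        using 1 by (simp add: Wc)
    qed (use nexp in auto)
    also have "\<dots> = exp (3 * t * real (2 * c + 1) + t + 4 * t + (16 * t ^ 5 - t ^ 7))"
    proof -
      have "exp (3 * t) ^ (2 * c + 1) = exp (3 * t * real (2 * c + 1))" "(exp (2 * t))\<^sup>2 = exp (4 * t)"
        by (simp_all only: exp_of_nat_mult[symmetric] mult.commute) (simp add: exp_double[symmetric])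
      then show ?thesis by (simp only: exp_add)
    qed
    also have "\<dots> \<le> exp (- (2 * t))"
    proof -
      have "3 * t * real (2 * c + 1) \<le> 3 * t * (2 * t)"
        using c L t by (intro mult_left_mono) auto
      also have "\<dots> = 6 * t\<^sup>2" by (simp add: power2_eq_square)
      also have "\<dots> \<le> 6 * t ^ 5" using tpow[of 2 5] by simp
      finally have "3 * t * real (2 * c + 1) \<le> 6 * t ^ 5" .
      moreover have "t \<le> t ^ 5" using tpow[of 1 5] by simp
      moreover have "t ^ 5 * 10\<^sup>2 \<le> t ^ 5 * t\<^sup>2" using t by (intro mult_left_mono power_mono) auto
      then have "100 * t ^ 5 \<le> t ^ 7" by (simp add: power_add[symmetric])
      ultimately have "3 * t * real (2 * c + 1) + t + 4 * t + (16 * t ^ 5 - t ^ 7) \<le> - (2 * t)"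
        using t by linarith
      then show ?thesis by simp
    qed
    finally show ?thesis .
  qed
  have B: "?M {E. \<not> small_peaks b c k {..<n} E (\<gamma> + 1) K} \<le> exp (- t)"
  proof -
    have "exp (- (2 * t)) \<le> 1" using t by simp
    then have "?M {E. \<not> small_peaks b c k {..<n} E (\<gamma> + 1) K} \<le> real (\<gamma> + 1) * \<rho>"
      using prob_not_small_peaks_le[OF p b_def, of n k c "\<gamma> + 1" K] \<rho> unfolding \<rho>_def by linarith
    \<comment> \<open>The factor \<open>\<gamma> + 1 \<le> n \<le> exp t\<close> uses up half of the
      exponent \<open>2 * t\<close>.\<close>
    also have "\<dots> \<le> exp t * exp (- (2 * t))"
      using \<gamma>n nexp \<rho> by (intro mult_mono) (auto simp: \<rho>_def)
    also have "\<dots> = exp (- t)" by (simp add: exp_add[symmetric])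
    finally show ?thesis .
  qed
  let ?S = "{E. real (game_chromatic_number {..<n} E) \<le> (1 + \<epsilon>) * (real n / L)}"
  have "- ?S \<subseteq> {E. \<not> few_light b c k {..<n} E \<Lambda> \<gamma>} \<union> {E. \<not> small_peaks b c k {..<n} E (\<gamma> + 1) K}"
  proof
    fix E assume E: "E \<in> - ?S"
    have "\<not> (few_light b c k {..<n} E \<Lambda> \<gamma> \<and> small_peaks b c k {..<n} E (\<gamma> + 1) K)"
    proof
      assume "few_light b c k {..<n} E \<Lambda> \<gamma> \<and> small_peaks b c k {..<n} E (\<gamma> + 1) K"
      then have "game_chromatic_number {..<n} E \<le> k"
        using game_chromatic_number_le[OF _ b1 _ _ K0 K\<Lambda> \<Lambda>k] by blast
      then show False using E k(1) by auto
    qed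
    then show "E \<in> {E. \<not> few_light b c k {..<n} E \<Lambda> \<gamma>} \<union> {E. \<not> small_peaks b c k {..<n} E (\<gamma> + 1) K}"
      by auto
  qed
  then have "?M (- ?S) \<le> ?M ({E. \<not> few_light b c k {..<n} E \<Lambda> \<gamma>} \<union> {E. \<not> small_peaks b c k {..<n} E (\<gamma> + 1) K})"
    by (rule measure_pmf.finite_measure_mono) simp
  also have "\<dots> \<le> ?M {E. \<not> few_light b c k {..<n} E \<Lambda> \<gamma>} + ?M {E. \<not> small_peaks b c k {..<n} E (\<gamma> + 1) K}"
    by (rule measure_Un_le) auto
  also have "\<dots> \<le> 2 * exp (- t)" using A B by simp
  finally have "?M (- ?S) \<le> 2 * exp (- t)" .
  moreover have "?M (- ?S) = 1 - ?M ?S"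
    using measure_pmf.prob_compl[of ?S] by (simp add: Compl_eq_Diff_UNIV)
  ultimately show ?thesis by linarith
qed

text \<open>The preceding lemma is applied with \<open>t\<close> a small power of \<open>n\<close>,
  which still exceeds \<open>L\<close> because \<open>p\<close> is at least \<open>n\<close> to the
  power \<open>-o(1)\<close>.\<close>

lemma game_chromatic_number_whp:
  fixes \<eta> \<epsilon> :: real and p f :: "nat \<Rightarrow> real"
  assumes \<eta>: "\<eta> > 0" and f: "f \<in> o(\<lambda>n. ln (real n))"
    and p: "\<forall>\<^sub>F n in sequentially. exp (- f n) \<le> p n \<and> p n \<le> 1 - \<eta>"
    and \<epsilon>: "0 < \<epsilon>" "\<epsilon> \<le> 1"
  shows "\<forall>\<^sub>F n in sequentially. log (1 / (1 - p n)) (real n * p n) \<ge> 2 \<and>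
    measure_pmf.prob (random_graph n (p n))
      {E. real (game_chromatic_number {..<n} E) \<le>
         (1 + \<epsilon>) * (real n / log (1 / (1 - p n)) (real n * p n))} \<ge> 1 - \<epsilon>"
proof -
  \<comment> \<open>Chosen such that \<open>1 / (1 + \<epsilon> / 2) = 1 - \<delta>\<close>. Below,
    \<open>t = n powr (2 * a)\<close> with \<open>a = \<delta> / 80\<close> yields
    \<open>t ^ 20 = n powr (\<delta> / 2)\<close>.\<close>
  define \<delta> where "\<delta> = \<epsilon> / (2 + \<epsilon>)"
  have \<delta>: "0 < \<delta>" "\<delta> < 1" using \<epsilon> by (auto simp: \<delta>_def)
  define a where "a = \<delta> / 80"
  have a: "0 < a" "a < 1 / 80" using \<delta> by (auto simp: a_def)
  define lb where "lb = ln (1 / \<eta>)"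
  have f': "\<forall>\<^sub>F n in sequentially. norm (f n) \<le> a * norm (ln (real n))"
    using landau_o.smallD[OF f a(1)] .
  have e1: "\<forall>\<^sub>F n in sequentially. ln (real n) \<le> real n powr (2 * a)" using a(1) by real_asymp
  have e2: "\<forall>\<^sub>F n in sequentially. ln (real n) * real n powr a + 1 \<le> real n powr (2 * a)"
    using a(1) by real_asymp
  have e3: "\<forall>\<^sub>F n in sequentially. (1 - a) * ln (real n) \<ge> 2 * lb" using a by real_asymp
  have e4: "\<forall>\<^sub>F n in sequentially. real n powr (2 * a) \<ge> 10" using a(1) by real_asymp
  have e5: "\<forall>\<^sub>F n in sequentially. real n powr (2 * a) \<ge> 8 / \<epsilon>" using a(1) by real_asymp
  have "(\<lambda>n. 2 * exp (- (real n powr (2 * a)))) \<longlonglongrightarrow> 0" using a(1) by real_asymp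
  then have e6: "\<forall>\<^sub>F n in sequentially. 2 * exp (- (real n powr (2 * a))) < \<epsilon>"
    using \<epsilon>(1) by (rule order_tendstoD)
  from p f' e1 e2 e3 e4 e5 e6 eventually_gt_at_top[of 1] show ?thesis
  proof eventually_elim
    case (elim n)
    define q where "q = p n"
    define b where "b = 1 / (1 - q)"
    define L where "L = log b (real n * q)"
    define t where "t = real n powr (2 * a)"
    have n: "real n > 1" using elim by simp
    have lnn: "ln (real n) > 0" using n by simp
    have fn: "f n \<le> a * ln (real n)" using elim lnn by simp
    have q: "exp (- f n) \<le> q" "q \<le> 1 - \<eta>" using elim by (auto simp: q_def)
    have q0: "q > 0" using q(1) by (rule less_le_trans[OF exp_gt_zero])
    have q1: "q < 1" using q(2) \<eta> by simp
    have b1: "b > 1" using q0 q1 by (simp add: b_def)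
    have lnb: "ln b = - ln (1 - q)" using q1 by (simp add: b_def ln_div)
    have lnq: "ln q \<ge> - (a * ln (real n))"
      using q(1) fn q0 by (smt (verit) ln_exp ln_le_cancel_iff exp_gt_zero)
    have lnnq: "ln (real n * q) = ln (real n) + ln q" using n q0 by (simp add: ln_mult)
    have lnnq_le: "ln (real n * q) \<le> ln (real n)" using lnnq q0 q1 by simp
    have lnb_lb: "ln b \<le> lb"
      unfolding lnb lb_def using q(2) \<eta> q1 by (simp add: ln_div)
    have lnb0: "ln b > 0" using b1 by simp
    have L: "L = ln (real n * q) / ln b" by (simp add: L_def log_def)
    \<comment> \<open>Here \<open>p \<le> 1 - \<eta>\<close> enters: it keeps \<open>ln b\<close>
      bounded by \<open>lb\<close>, while \<open>ln (n * q) \<ge> (1 - a) * ln n\<close>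
      grows.\<close>
    have L2: "L \<ge> 2"
    proof -
      have "2 * ln b \<le> 2 * lb" using lnb_lb by simp
      also have "\<dots> \<le> (1 - a) * ln (real n)" using elim by simp
      also have "\<dots> \<le> ln (real n * q)" using lnnq lnq by (simp add: algebra_simps)
      finally show ?thesis using lnb0 by (simp add: L field_simps)
    qed
    have Lt: "L + 1 \<le> t"
    proof -
      \<comment> \<open>For small \<open>q\<close> the base is close to 1 and \<open>L\<close> is
        large; \<open>ln b \<ge> q \<ge> n powr (-a)\<close> still gives
        \<open>L \<le> ln n * n powr a\<close>.\<close>
      have lnb_q: "q \<le> ln b" using ln_le_minus_one[of "1 - q"] q1 by (simp add: lnb)
      have "L \<le> ln (real n) / ln b" unfolding L using lnnq_le lnb0 by (intro divide_right_mono) auto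
      also have "\<dots> \<le> ln (real n) / q" using lnb_q q0 lnn by (intro divide_left_mono) auto
      also have "\<dots> \<le> ln (real n) / exp (- f n)" using q q0 lnn by (intro divide_left_mono) auto
      also have "\<dots> = ln (real n) * exp (f n)" by (simp add: exp_minus field_simps)
      also have "\<dots> \<le> ln (real n) * exp (a * ln (real n))" using fn lnn by (intro mult_left_mono) auto
      also have "exp (a * ln (real n)) = real n powr a" using n by (simp add: powr_def)
      finally show ?thesis using elim by (simp add: t_def)
    qed
    have W: "b ^ nat \<lfloor>L / (1 + \<epsilon> / 2)\<rfloor> * t ^ 20 \<le> real n"
    proof -
      have "b ^ nat \<lfloor>L / (1 + \<epsilon> / 2)\<rfloor> = b powr real (nat \<lfloor>L / (1 + \<epsilon> / 2)\<rfloor>)"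
        using b1 by (simp add: powr_realpow)
      also have "\<dots> \<le> b powr (L / (1 + \<epsilon> / 2))"
        using b1 L2 \<epsilon> by (intro powr_mono) auto
      also have "\<dots> = exp (ln (real n * q) / (1 + \<epsilon> / 2))"
        using b1 lnb0 by (simp add: powr_def L)
      also have "\<dots> \<le> exp (ln (real n) / (1 + \<epsilon> / 2))"
        using lnnq_le \<epsilon> by (simp add: divide_right_mono)
      also have "ln (real n) / (1 + \<epsilon> / 2) = (1 - \<delta>) * ln (real n)"
        using \<epsilon> by (simp add: \<delta>_def field_simps)
      also have "exp \<dots> = real n powr (1 - \<delta>)" using n by (simp add: powr_def)
      finally have "b ^ nat \<lfloor>L / (1 + \<epsilon> / 2)\<rfloor> * t ^ 20 \<le> real n powr (1 - \<delta>) * t ^ 20"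
        by (intro mult_right_mono) (auto simp: t_def)
      also have "real n powr (1 - \<delta>) * t ^ 20 = real n powr (1 - \<delta> / 2)"
        using n by (simp add: t_def a_def powr_power powr_add[symmetric])
      also have "\<dots> \<le> real n powr 1" using n \<delta> by (intro powr_mono) auto
      finally show ?thesis using n by simp
    qed
    have "measure_pmf.prob (random_graph n q)
      {E. real (game_chromatic_number {..<n} E) \<le> (1 + \<epsilon>) * (real n / L)} \<ge> 1 - 2 * exp (- t)"
      using elim q0 q1 by (intro prob_game_chromatic_number_le[OF _ _ b_def \<epsilon> _ _ L2 Lt _ W]) (auto simp: t_def)
    then show ?case using L2 elim by (simp add: L_def b_def q_def t_def)
  qed
qed

theorem theorem2:
  fixes \<eta> :: real and p f :: "nat \<Rightarrow> real"
  assumes "\<eta> > 0"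
    and "f \<in> o(\<lambda>n. ln (real n))"
    and "\<forall>\<^sub>F n in sequentially. exp (- f n) \<le> p n \<and> p n \<le> 1 - \<eta>"
  shows "\<exists>\<epsilon> :: nat \<Rightarrow> real. \<epsilon> \<in> o(\<lambda>_. 1) \<and>
    (\<lambda>n. let b = 1 / (1 - p n) in
       measure_pmf.prob (random_graph n (p n))
         {E. real (game_chromatic_number {..<n} E)
               \<le> (1 + \<epsilon> n) * (real n / log b (real n * p n))})
      \<longlonglongrightarrow> 1"
proof -
  define L where "L n = log (1 / (1 - p n)) (real n * p n)" for n
  define P where "P n e = measure_pmf.prob (random_graph n (p n))
      {E. real (game_chromatic_number {..<n} E) \<le> (1 + e) * (real n / L n)}" for n and e :: real
  \<comment> \<open>Diagonalisation: one null sequence has to replace the fixed values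
    \<open>e\<close>. The infimum need not be attained, so \<open>1 / Suc n\<close> is added to get
    strictly above it.\<close>
  define S where "S n = {e. 0 < e \<and> 1 - e \<le> P n e}" for n
  define \<epsilon> where "\<epsilon> n = Inf (S n) + 1 / real (Suc n)" for n
  have whp: "\<forall>\<^sub>F n in sequentially. 2 \<le> L n \<and> 1 - e \<le> P n e" if "0 < e" "e \<le> 1" for e
    using game_chromatic_number_whp[OF assms that] by (simp only: L_def P_def)
  have "1 \<in> S n" for n by (simp add: S_def P_def)
  then have ne: "S n \<noteq> {}" for n by blast
  have bdd: "bdd_below (S n)" for n by (rule bdd_belowI[of _ 0]) (auto simp: S_def)
  have Inf0: "Inf (S n) \<ge> 0" for n using ne by (intro cInf_greatest) (auto simp: S_def)
  \<comment> \<open>Positivity of \<open>L n\<close> makes the bound on the game chromatic number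
    increasing in \<open>e\<close>.\<close>
  have "\<forall>\<^sub>F n in sequentially. L n \<ge> 2" using whp[of 1] by (auto elim: eventually_mono)
  then have P_\<epsilon>: "\<forall>\<^sub>F n in sequentially. 1 - \<epsilon> n \<le> P n (\<epsilon> n)"
  proof eventually_elim
    case (elim n)
    have "Inf (S n) < \<epsilon> n" by (simp add: \<epsilon>_def)
    then obtain e where e: "e \<in> S n" "e < \<epsilon> n" using cInf_lessD[OF ne] by blast
    have "P n e \<le> P n (\<epsilon> n)"
      unfolding P_def
    proof (rule measure_pmf.finite_measure_mono)
      have "(1 + e) * (real n / L n) \<le> (1 + \<epsilon> n) * (real n / L n)"
        using e(2) elim by (intro mult_right_mono) auto
      then show "{E. real (game_chromatic_number {..<n} E) \<le> (1 + e) * (real n / L n)} \<subseteq>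
          {E. real (game_chromatic_number {..<n} E) \<le> (1 + \<epsilon> n) * (real n / L n)}" by auto
    qed simp
    then show ?case using e by (simp add: S_def)
  qed
  have \<epsilon>0: "\<epsilon> \<longlonglongrightarrow> 0"
  proof (rule order_tendstoI)
    fix x :: real assume "x < 0"
    moreover have "\<epsilon> n > 0" for n
      unfolding \<epsilon>_def using Inf0[of n] by (intro add_nonneg_pos) auto
    ultimately have "x < \<epsilon> n" for n by (rule order.strict_trans)
    then show "\<forall>\<^sub>F n in sequentially. x < \<epsilon> n" by simp
  next
    fix x :: real assume x: "0 < x"
    define e where "e = min 1 (x / 2)"
    have e: "0 < e" "e \<le> 1" "e \<le> x / 2" using x by (auto simp: e_def)
    have "\<forall>\<^sub>F n in sequentially. 1 / real (Suc n) < x / 2" using x by real_asymp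
    with whp[OF e(1,2)] show "\<forall>\<^sub>F n in sequentially. \<epsilon> n < x"
    proof eventually_elim
      case (elim n)
      then have "e \<in> S n" using e by (simp add: S_def)
      then have "Inf (S n) \<le> e" by (rule cInf_lower[OF _ bdd])
      then show ?case using elim e by (simp add: \<epsilon>_def)
    qed
  qed
  have "(\<lambda>n. P n (\<epsilon> n)) \<longlonglongrightarrow> 1"
  proof (rule tendsto_sandwich)
    show "(\<lambda>n. 1 - \<epsilon> n) \<longlonglongrightarrow> 1" using tendsto_diff[OF tendsto_const \<epsilon>0, of 1] by simp
    show "\<forall>\<^sub>F n in sequentially. P n (\<epsilon> n) \<le> 1" by (simp add: P_def)
  qed (use P_\<epsilon> in auto)
  moreover have "\<epsilon> \<in> o(\<lambda>_. 1)" using \<epsilon>0 by (intro smalloI_tendsto) auto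
  ultimately show ?thesis by (auto simp: P_def L_def Let_def)
qed

end
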